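(* Let $\beta$ be the fixed matrix representation of the generalized Clifford algebra $C\ell^{\frac1m}_d$ described in the context. Then $$(\beta(U))^{\rm H}=\beta(\overline{U}),\qquad \forall\, U\in C\ell^{\frac1m}_d,$$ where ${\rm H}$ denotes the Hermitian transpose of a matrix and $\overline{U}$ is the operation on $C\ell^{\frac1m}_d$ defined in the context.
   Context: The generalized (complex) Clifford algebra $C\ell^{\frac1m}_d$ is the unital associative algebra over $\mathbb{C}$ with identity $e$ and generators $e_1,\dots,e_d$ subject to $e_j^m=e$ for $j=1,\dots,d$ and $e_ke_l=\omega e_le_k$ for $k<l$, where $\omega:=e^{2\pi i/m}$. It has dimension $m^d$ with basis $e_1^{j_1}\cdots e_d^{j_d}$, $0\le j_1,\dots,j_d\le m-1$ (each basis element is invertible), so each element is uniquely $U=\sum_{j_1,\dots,j_d=0}^{m-1}u_{j_1\ldots j_d}e_1^{j_1}\cdots e_d^{j_d}$ with $u_{j_1\ldots j_d}\in\mathbb{C}$. Operation $\overline{U}$: $\overline{U}:=\sum_{j_1,\dots,j_d=0}^{m-1}\overline{u_{j_1\ldots j_d}}\,(e_1^{j_1}\cdots e_d^{j_d})^{-1}$, where $\overline{u}$ is complex conjugation for $u\in\mathbb{C}$. Matrices: let $P$ be the $m\times m$ matrix with $P_{j,j+1}=1$ for $1\le j\le m-1$, $P_{m,1}=1$ and all other entries $0$. If $m$ is odd, let $Q$ be the $m\times m$ matrix with $Q_{j,j+1}=\omega^j$ for $1\le j\le m-1$, $Q_{m,1}=1$ and all other entries $0$. If $m$ is even, let $\zeta$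 be a primitive $2m$-th root of unity with $\zeta^2=\omega$, and let $Q$ have $Q_{j,j+1}=\zeta^{2j-1}$ for $1\le j\le m-1$, $Q_{m,1}=\zeta^{2m-1}$ and all other entries $0$. Let $R:=P^{m-1}Q$ for odd $m$ and $R:=\zeta P^{m-1}Q$ for even $m$; in both cases $R={\rm diag}(1,\omega,\omega^2,\dots,\omega^{m-1})$. Let $I$ be the $m\times m$ identity matrix. Representation $\beta$: a matrix representation of $C\ell^{\frac1m}_d$ by matrices of size $N=m^{\frac d2}$ ($d$ even) or $N=m^{\frac{d+1}2}$ ($d$ odd), with $\beta(e)$ the identity matrix and $\beta(e_1^{j_1}\cdots e_d^{j_d})=\beta(e_1)^{j_1}\cdots\beta(e_d)^{j_d}$, extended linearly, where the matrices of the generators are fixed as follows. For even $d$, $\beta(e_i)=\beta_i$ with $$\beta_i:=\underbrace{R\otimes\cdots\otimes R}_{i-1}\otimes P\otimes\underbrace{I\otimes\cdots\otimes I}_{\frac d2-i},\qquad i=1,\dots,\tfrac d2,$$ $$\beta_i:=\underbrace{R\otimes\cdots\otimes R}_{i-\frac d2-1}\otimes Q\otimes\underbrace{I\otimes\cdots\otimes I}_{d-i},\qquad i=\tfrac d2+1,\dots,d,$$ each product having $\frac d2$ factors. For odd $d$, let $\beta_1,\dots,\beta_{d-1}$ be the matrices just defined for the even number $d-1$ of generators, let $\beta_d:=R\otimes\cdots\otimes R$ ($\frac{d-1}{2}$ factors), and put $\beta(e_i)={\rm diag}(\beta_i,\omega\beta_i,\dots,\omega^{m-1}\beta_i)$ (block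 diagonal) for $i=1,\dots,d$.
   Formalization: For m ≥ 3, d ≥ 4 the listed β_i violate e_k e_l = ω e_l e_k (d = 4: β_2β_3 = ω^{-1}β_3β_2), so no such representation exists; the formal theorem covers any representation β sending e_i to the listed matrix with index σ(i), for any permutation σ (σ = id is the listed order). *)

theory Defs
  imports
    "HOL-Algebra.QuotRing"
    "HOL-Library.FuncSet"
    "HOL-Combinatorics.Permutations"
    "Jordan_Normal_Form.Matrix"
    "Jordan_Normal_Form.Schur_Decomposition"
begin

section \<open>The generalized Clifford algebra\<close>

definition omega :: "nat \<Rightarrow> complex"
  where "omega m = exp (2 * of_real pi * \<i> / of_nat m)"

text \<open>The free unital associative complex algebra on the letters \<open>1, \<dots>, d\<close>: finitely supported
  functions on words, i.e. noncommutative polynomials, with the product given by concatenation of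
  words.\<close>

definition free_alg :: "nat \<Rightarrow> (nat list \<Rightarrow> complex) ring"
  where "free_alg d =
    \<lparr>carrier = {f. finite {w. f w \<noteq> 0} \<and> (\<forall>w. f w \<noteq> 0 \<longrightarrow> set w \<subseteq> {1..d})},
     monoid.mult = (\<lambda>f g w. \<Sum>k\<le>length w. f (take k w) * g (drop k w)),
     one = (\<lambda>w. if w = [] then 1 else 0),
     zero = (\<lambda>w. 0),
     add = (\<lambda>f g w. f w + g w)\<rparr>"

lemma free_alg_mult_nonzeroE:
  assumes "(\<Sum>k\<le>length w. f (take k w) * g (drop k w)) \<noteq> (0 :: complex)"
  obtains u v where "w = u @ v" "f u \<noteq> 0" "g v \<noteq> 0"
proof -
  obtain k where "f (take k w) * g (drop k w) \<noteq> 0"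
    using assms by (metis (no_types, lifting) sum.neutral)
  then show ?thesis
    using that[of "take k w" "drop k w"] by simp
qed

lemma free_alg_mult_assoc:
  fixes f g h :: "nat list \<Rightarrow> complex"
  shows "(\<Sum>k\<le>length w. (\<Sum>i\<le>length (take k w). f (take i (take k w)) * g (drop i (take k w)))
           * h (drop k w)) =
         (\<Sum>i\<le>length w. f (take i w) *
           (\<Sum>j\<le>length (drop i w). g (take j (drop i w)) * h (drop j (drop i w))))"
proof -
  have "(\<Sum>k\<le>length w. (\<Sum>i\<le>length (take k w). f (take i (take k w)) * g (drop i (take k w)))
           * h (drop k w)) =
        (\<Sum>k\<le>length w. \<Sum>i\<le>k. f (take i w) * g (take (k - i) (drop i w)) * h (drop k w))"
    by (intro sum.cong) (auto simp: sum_distrib_right min_def drop_take)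
  also have "\<dots> = (\<Sum>(k, i)\<in>(SIGMA k:{..length w}. {..k}).
      f (take i w) * g (take (k - i) (drop i w)) * h (drop k w))"
    by (rule sum.Sigma) auto
  also have "\<dots> = (\<Sum>(i, j)\<in>(SIGMA i:{..length w}. {..length w - i}).
      f (take i w) * (g (take j (drop i w)) * h (drop j (drop i w))))"
    by (rule sum.reindex_bij_witness
          [where i = "\<lambda>(i, j). (i + j, i)" and j = "\<lambda>(k, i). (i, k - i)"])
       (auto simp: mult.assoc add.commute)
  also have "\<dots> = (\<Sum>i\<le>length w. \<Sum>j\<le>length w - i.
      f (take i w) * (g (take j (drop i w)) * h (drop j (drop i w))))"
    by (rule sum.Sigma[symmetric]) auto
  finally show ?thesis
    by (simp add: sum_distrib_left)
qed

lemma free_alg_mult_closed: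
  assumes "f \<in> carrier (free_alg d)" "g \<in> carrier (free_alg d)"
  shows "f \<otimes>\<^bsub>free_alg d\<^esub> g \<in> carrier (free_alg d)"
proof -
  have "{w. (f \<otimes>\<^bsub>free_alg d\<^esub> g) w \<noteq> 0} \<subseteq> (\<lambda>(u, v). u @ v) ` ({u. f u \<noteq> 0} \<times> {v. g v \<noteq> 0})"
    by (auto simp: free_alg_def elim!: free_alg_mult_nonzeroE)
  moreover have "finite ({u. f u \<noteq> 0} \<times> {v. g v \<noteq> 0})"
    using assms by (simp add: free_alg_def)
  ultimately have "finite {w. (f \<otimes>\<^bsub>free_alg d\<^esub> g) w \<noteq> 0}"
    by (meson finite_imageI finite_subset)
  moreover have "set w \<subseteq> {1..d}" if "(f \<otimes>\<^bsub>free_alg d\<^esub> g) w \<noteq> 0" for w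
  proof -
    from that have "(\<Sum>k\<le>length w. f (take k w) * g (drop k w)) \<noteq> 0"
      by (simp add: free_alg_def)
    then obtain u v where "w = u @ v" "f u \<noteq> 0" "g v \<noteq> 0"
      by (rule free_alg_mult_nonzeroE)
    with assms show ?thesis
      by (simp add: free_alg_def)
  qed
  ultimately show ?thesis
    by (simp add: free_alg_def)
qed

lemma free_alg_add_closed:
  assumes "f \<in> carrier (free_alg d)" "g \<in> carrier (free_alg d)"
  shows "f \<oplus>\<^bsub>free_alg d\<^esub> g \<in> carrier (free_alg d)"
proof -
  have "{w. f w + g w \<noteq> 0} \<subseteq> {w. f w \<noteq> 0} \<union> {w. g w \<noteq> 0}"
    by auto
  moreover have "finite ({w. f w \<noteq> 0} \<union> {w. g w \<noteq> 0})"
    using assms by (simp add: free_alg_def)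
  ultimately have "finite {w. f w + g w \<noteq> 0}"
    by (rule finite_subset)
  moreover have "set w \<subseteq> {1..d}" if "f w + g w \<noteq> 0" for w
  proof (cases "f w = 0")
    case True
    then show ?thesis using that assms(2) by (simp add: free_alg_def)
  next
    case False
    then show ?thesis using assms(1) by (simp add: free_alg_def)
  qed
  ultimately show ?thesis
    by (simp add: free_alg_def)
qed

lemma free_alg_abelian_group: "abelian_group (free_alg d)"
proof (rule abelian_groupI)
  fix f assume f: "f \<in> carrier (free_alg d)"
  then show "\<exists>g\<in>carrier (free_alg d). g \<oplus>\<^bsub>free_alg d\<^esub> f = \<zero>\<^bsub>free_alg d\<^esub>"
    by (intro bexI[where x = "\<lambda>w. - f w"]) (simp_all add: free_alg_def)
next
  fix f g assume "f \<in> carrier (free_alg d)" "g \<in> carrier (free_alg d)"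
  then show "f \<oplus>\<^bsub>free_alg d\<^esub> g \<in> carrier (free_alg d)"
    by (rule free_alg_add_closed)
qed (simp_all add: free_alg_def algebra_simps)

lemma free_alg_l_one: "\<one>\<^bsub>free_alg d\<^esub> \<otimes>\<^bsub>free_alg d\<^esub> f = f"
proof
  fix w :: "nat list"
  have "(\<Sum>k\<le>length w. (if take k w = [] then 1 else 0) * f (drop k w)) =
        (\<Sum>k\<le>length w. if k = 0 then f w else 0)"
    by (intro sum.cong) auto
  then show "(\<one>\<^bsub>free_alg d\<^esub> \<otimes>\<^bsub>free_alg d\<^esub> f) w = f w"
    by (simp add: free_alg_def)
qed

lemma free_alg_r_one: "f \<otimes>\<^bsub>free_alg d\<^esub> \<one>\<^bsub>free_alg d\<^esub> = f"
proof
  fix w :: "nat list"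
  have "(\<Sum>k\<le>length w. f (take k w) * (if drop k w = [] then 1 else 0)) =
        (\<Sum>k\<le>length w. if k = length w then f w else 0)"
    by (intro sum.cong) auto
  then show "(f \<otimes>\<^bsub>free_alg d\<^esub> \<one>\<^bsub>free_alg d\<^esub>) w = f w"
    by (simp add: free_alg_def)
qed

lemma free_alg_ring: "ring (free_alg d)"
proof (rule ringI)
  show "abelian_group (free_alg d)"
    by (rule free_alg_abelian_group)
  show "Group.monoid (free_alg d)"
  proof (rule Group.monoidI)
    fix f g h
    show "f \<otimes>\<^bsub>free_alg d\<^esub> g \<otimes>\<^bsub>free_alg d\<^esub> h = f \<otimes>\<^bsub>free_alg d\<^esub> (g \<otimes>\<^bsub>free_alg d\<^esub> h)"
      unfolding free_alg_def monoid.simps by (intro ext free_alg_mult_assoc)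
  next
    show "\<one>\<^bsub>free_alg d\<^esub> \<in> carrier (free_alg d)"
      by (simp add: free_alg_def)
  qed (simp_all only: free_alg_mult_closed free_alg_l_one free_alg_r_one)
qed (simp_all add: free_alg_def distrib_left distrib_right sum.distrib)

definition free_gen :: "nat \<Rightarrow> nat list \<Rightarrow> complex"
  where "free_gen j = (\<lambda>w. if w = [j] then 1 else 0)"

definition free_scalar :: "complex \<Rightarrow> nat list \<Rightarrow> complex"
  where "free_scalar c = (\<lambda>w. if w = [] then c else 0)"

definition gca_relators :: "nat \<Rightarrow> nat \<Rightarrow> (nat list \<Rightarrow> complex) set"
  where "gca_relators m d =
    {free_gen j [^]\<^bsub>free_alg d\<^esub> m \<ominus>\<^bsub>free_alg d\<^esub> \<one>\<^bsub>free_alg d\<^esub> | j. j \<in> {1..d}} \<union>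
    {(free_gen k \<otimes>\<^bsub>free_alg d\<^esub> free_gen l) \<ominus>\<^bsub>free_alg d\<^esub>
       (free_scalar (omega m) \<otimes>\<^bsub>free_alg d\<^esub> (free_gen l \<otimes>\<^bsub>free_alg d\<^esub> free_gen k))
      | k l. k \<in> {1..d} \<and> l \<in> {1..d} \<and> k < l}"

definition gca_ideal :: "nat \<Rightarrow> nat \<Rightarrow> (nat list \<Rightarrow> complex) set"
  where "gca_ideal m d = genideal (free_alg d) (gca_relators m d)"

definition gca :: "nat \<Rightarrow> nat \<Rightarrow> (nat list \<Rightarrow> complex) set ring"
  where "gca m d = free_alg d Quot gca_ideal m d"

lemma gca_relators_subset: "gca_relators m d \<subseteq> carrier (free_alg d)"
proof -
  interpret F: ring "free_alg d"
    by (rule free_alg_ring)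
  have gen: "free_gen j \<in> carrier (free_alg d)" if "j \<in> {1..d}" for j
    using that by (auto simp: free_alg_def free_gen_def)
  have scalar: "free_scalar c \<in> carrier (free_alg d)" for c
    by (auto simp: free_alg_def free_scalar_def)
  show ?thesis
    unfolding gca_relators_def by (auto intro!: F.minus_closed F.m_closed F.nat_pow_closed gen scalar)
qed

lemma gca_ideal: "ideal (gca_ideal m d) (free_alg d)"
  unfolding gca_ideal_def by (intro ring.genideal_ideal free_alg_ring gca_relators_subset)

lemma gca_ring: "ring (gca m d)"
  unfolding gca_def by (rule ideal.quotient_is_ring[OF gca_ideal])

definition gca_gen :: "nat \<Rightarrow> nat \<Rightarrow> nat \<Rightarrow> (nat list \<Rightarrow> complex) set"
  where "gca_gen m d j = gca_ideal m d +>\<^bsub>free_alg d\<^esub> free_gen j"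

definition gca_scale ::
    "nat \<Rightarrow> nat \<Rightarrow> complex \<Rightarrow> (nat list \<Rightarrow> complex) set \<Rightarrow> (nat list \<Rightarrow> complex) set"
  where "gca_scale m d c U =
    (gca_ideal m d +>\<^bsub>free_alg d\<^esub> free_scalar c) \<otimes>\<^bsub>gca m d\<^esub> U"

text \<open>A multi-index \<open>(j\<^sub>1, \<dots>, j\<^sub>d)\<close> is an extensional function on \<open>{1..d}\<close>;
  the factors of \<open>e\<^sub>1^{j\<^sub>1} \<cdots> e\<^sub>d^{j\<^sub>d}\<close> are multiplied in this order.\<close>

definition multi_indices :: "nat \<Rightarrow> nat \<Rightarrow> (nat \<Rightarrow> nat) set"
  where "multi_indices m d = {1..d} \<rightarrow>\<^sub>E {0..m-1}"

definition gca_monom :: "nat \<Rightarrow> nat \<Rightarrow> (nat \<Rightarrow> nat) \<Rightarrow> (nat list \<Rightarrow> complex) set"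
  where "gca_monom m d J =
    foldr (\<lambda>i x. (gca_gen m d i [^]\<^bsub>gca m d\<^esub> J i) \<otimes>\<^bsub>gca m d\<^esub> x) [1..<d+1] \<one>\<^bsub>gca m d\<^esub>"

definition gca_coeff ::
    "nat \<Rightarrow> nat \<Rightarrow> (nat list \<Rightarrow> complex) set \<Rightarrow> (nat \<Rightarrow> nat) \<Rightarrow> complex"
  where "gca_coeff m d U =
    (THE u. u \<in> extensional (multi_indices m d) \<and>
       U = (\<Oplus>\<^bsub>gca m d\<^esub>J\<in>multi_indices m d. gca_scale m d (u J) (gca_monom m d J)))"

definition gca_bar ::
    "nat \<Rightarrow> nat \<Rightarrow> (nat list \<Rightarrow> complex) set \<Rightarrow> (nat list \<Rightarrow> complex) set"
  where "gca_bar m d U =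
    (\<Oplus>\<^bsub>gca m d\<^esub>J\<in>multi_indices m d.
       gca_scale m d (cnj (gca_coeff m d U J)) (inv\<^bsub>gca m d\<^esub> (gca_monom m d J)))"


section \<open>The matrices of the representation\<close>

definition primitive_unity_root :: "nat \<Rightarrow> complex \<Rightarrow> bool"
  where "primitive_unity_root n z \<longleftrightarrow> z ^ n = 1 \<and> (\<forall>k. 0 < k \<and> k < n \<longrightarrow> z ^ k \<noteq> 1)"

text \<open>Square matrices given by entries with indices running from 1 to \<open>n\<close>.\<close>

definition mat1 :: "nat \<Rightarrow> (nat \<Rightarrow> nat \<Rightarrow> complex) \<Rightarrow> complex mat"
  where "mat1 n f = mat n n (\<lambda>(i, j). f (i + 1) (j + 1))"

definition P_mat :: "nat \<Rightarrow> complex mat"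
  where "P_mat m = mat1 m (\<lambda>j k. if k = j + 1 then 1 else if j = m \<and> k = 1 then 1 else 0)"

definition Q_mat :: "nat \<Rightarrow> complex \<Rightarrow> complex mat"
  where "Q_mat m \<zeta> =
    (if odd m
     then mat1 m (\<lambda>j k. if k = j + 1 then omega m ^ j else if j = m \<and> k = 1 then 1 else 0)
     else mat1 m (\<lambda>j k. if k = j + 1 then \<zeta> ^ (2 * j - 1)
                        else if j = m \<and> k = 1 then \<zeta> ^ (2 * m - 1) else 0))"

definition R_mat :: "nat \<Rightarrow> complex \<Rightarrow> complex mat"
  where "R_mat m \<zeta> =
    (if odd m then P_mat m ^\<^sub>m (m - 1) * Q_mat m \<zeta>
     else \<zeta> \<cdot>\<^sub>m (P_mat m ^\<^sub>m (m - 1) * Q_mat m \<zeta>))"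

definition kron :: "complex mat \<Rightarrow> complex mat \<Rightarrow> complex mat"
  where "kron A B = mat (dim_row A * dim_row B) (dim_col A * dim_col B)
    (\<lambda>(i, j). A $$ (i div dim_row B, j div dim_col B) * B $$ (i mod dim_row B, j mod dim_col B))"

definition kron_list :: "complex mat list \<Rightarrow> complex mat"
  where "kron_list As = foldr kron As (1\<^sub>m 1)"

text \<open>The matrices \<open>\<beta>\<^sub>i\<close>, \<open>1 \<le> i \<le> 2h\<close>, for the even number \<open>2h\<close> of generators.

  Pitfall: for \<open>m \<ge> 3\<close> and \<open>h \<ge> 2\<close> these matrices do not satisfy
  \<open>\<beta>\<^sub>k \<beta>\<^sub>l = \<omega> \<beta>\<^sub>l \<beta>\<^sub>k\<close> for all \<open>k < l\<close>: for example
  \<open>\<beta>\<^sub>2 \<beta>\<^bsub>h+1\<^esub> = \<omega>\<^sup>-\<^sup>1 \<beta>\<^bsub>h+1\<^esub> \<beta>\<^sub>2\<close>. They do so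
  when taken in the order \<open>\<beta>\<^sub>1, \<beta>\<^bsub>h+1\<^esub>, \<beta>\<^sub>2, \<beta>\<^bsub>h+2\<^esub>, \<dots>\<close>. Statements about the
  representation therefore assign \<open>\<beta>\<^bsub>\<sigma>(i)\<^esub>\<close> to \<open>e\<^sub>i\<close> for a permutation \<open>\<sigma>\<close> for which this
  defines a representation; \<open>\<sigma> = id\<close> is the order of the definition.\<close>

definition beta_even :: "nat \<Rightarrow> complex \<Rightarrow> nat \<Rightarrow> nat \<Rightarrow> complex mat"
  where "beta_even m \<zeta> h i =
    (if i \<le> h
     then kron_list (replicate (i - 1) (R_mat m \<zeta>) @ [P_mat m] @ replicate (h - i) (1\<^sub>m m))
     else kron_list (replicate (i - h - 1) (R_mat m \<zeta>) @ [Q_mat m \<zeta>] @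
            replicate (2 * h - i) (1\<^sub>m m)))"

definition beta_odd :: "nat \<Rightarrow> complex \<Rightarrow> nat \<Rightarrow> nat \<Rightarrow> complex mat"
  where "beta_odd m \<zeta> d i =
    (if i = d then kron_list (replicate ((d - 1) div 2) (R_mat m \<zeta>))
     else beta_even m \<zeta> ((d - 1) div 2) i)"

definition beta_gen :: "nat \<Rightarrow> complex \<Rightarrow> nat \<Rightarrow> nat \<Rightarrow> complex mat"
  where "beta_gen m \<zeta> d i =
    (if even d then beta_even m \<zeta> (d div 2) i
     else diag_block_mat (map (\<lambda>s. omega m ^ s \<cdot>\<^sub>m beta_odd m \<zeta> d i) [0..<m]))"

definition rep_size :: "nat \<Rightarrow> nat \<Rightarrow> nat"
  where "rep_size m d = (if even d then m ^ (d div 2) else m ^ ((d + 1) div 2))"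

text \<open>Matrix representations of size \<open>N\<close>: unital complex-algebra homomorphisms.\<close>

definition matrix_rep ::
    "nat \<Rightarrow> nat \<Rightarrow> nat \<Rightarrow> ((nat list \<Rightarrow> complex) set \<Rightarrow> complex mat) \<Rightarrow> bool"
  where "matrix_rep m d N \<beta> \<longleftrightarrow>
    \<beta> \<in> Ring.ring_hom (gca m d) (ring_mat TYPE(complex) N ()) \<and>
    (\<forall>c. \<forall>U\<in>carrier (gca m d). \<beta> (gca_scale m d c U) = c \<cdot>\<^sub>m \<beta> U)"

end

theory Submission
  imports Defs "HOL-Number_Theory.Cong" "HOL-Algebra.UnivPoly"
begin

text \<open>The matrices \<open>P\<close>, \<open>Q\<close>, \<open>R\<close> are unitary, and unitarity survives Kronecker products, block diagonals
  and unimodular scalars. So every generator, hence every monomial, is sent to a unitary matrix, and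
  \<open>\<beta> (E\<inverse>) = (\<beta> E)\<^sup>H\<close> for each monomial \<open>E\<close>; conjugate-linearity gives the claim.

  Since \<open>gca_coeff\<close> is a definite description, this needs the monomials to be a basis of the algebra.
  They span because words can be sorted and exponents reduced modulo \<open>m\<close>. For independence, the
  functional on the free algebra that sums the coefficients of the words \<open>w\<close> of a given degree modulo
  \<open>m\<close>, weighted by \<open>\<omega>\<close> to the power of minus the number of inversions of \<open>w\<close>, is supported on one
  monomial. The common kernel of these functionals is a two-sided ideal containing the relators.\<close>

section \<open>Unitarity of the generator matrices\<close>

lemma mat_adjoint_dim [simp]:
  "dim_row (mat_adjoint A) = dim_col A" "dim_col (mat_adjoint A) = dim_row A"
  by (simp_all add: mat_adjoint_def)

lemma mat_adjoint_index [simp]: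
  fixes A :: "complex mat"
  shows "i < dim_col A \<Longrightarrow> j < dim_row A \<Longrightarrow> mat_adjoint A $$ (i, j) = cnj (A $$ (j, i))"
  by (simp add: mat_adjoint_def mat_of_rows_def)

lemma mat_adjoint_carrier [simp]: "A \<in> carrier_mat n k \<Longrightarrow> mat_adjoint A \<in> carrier_mat k n"
  by (intro carrier_matI) auto

lemma mat_adjoint_one [simp]: "mat_adjoint (1\<^sub>m n :: complex mat) = 1\<^sub>m n"
  by (rule eq_matI) auto

lemma mat_adjoint_zero [simp]: "mat_adjoint (0\<^sub>m n k :: complex mat) = 0\<^sub>m k n"
  by (rule eq_matI) auto

lemma mat_adjoint_add:
  fixes A B :: "complex mat"
  shows "A \<in> carrier_mat n k \<Longrightarrow> B \<in> carrier_mat n k \<Longrightarrow>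
    mat_adjoint (A + B) = mat_adjoint A + mat_adjoint B"
  by (rule eq_matI) auto

lemma mat_adjoint_smult: "mat_adjoint (c \<cdot>\<^sub>m A) = cnj c \<cdot>\<^sub>m mat_adjoint A"
  by (rule eq_matI) auto

lemma mat_adjoint_mult:
  fixes A B :: "complex mat"
  assumes "A \<in> carrier_mat n k" "B \<in> carrier_mat k l"
  shows "mat_adjoint (A * B) = mat_adjoint B * mat_adjoint A"
  using assms by (intro eq_matI) (auto simp: scalar_prod_def mult.commute)

text \<open>The size is read off the matrix itself, so the predicate passes through nested Kronecker
  products and blocks without size parameters. Squareness is part of it because only one of the two
  products is required to be the identity.\<close>

definition unitary_mat :: "complex mat \<Rightarrow> bool"
  where "unitary_mat A \<longleftrightarrow> dim_col A = dim_row A \<and> A * mat_adjoint A = 1\<^sub>m (dim_row A)"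

lemma unitary_mat_one [simp]: "unitary_mat (1\<^sub>m n)"
  by (simp add: unitary_mat_def)

text \<open>A one-sided inverse of a square matrix over a field is two-sided.\<close>

lemma unitary_mat_adjoint_mult:
  assumes "unitary_mat A"
  shows "mat_adjoint A * A = 1\<^sub>m (dim_row A)"
  using assms by (intro mat_mult_left_right_inverse[of A]) (auto simp: unitary_mat_def intro!: carrier_matI)

lemma unitary_mat_mult:
  assumes "unitary_mat A" "unitary_mat B" "dim_row A = dim_row B"
  shows "unitary_mat (A * B)"
proof -
  define n where "n = dim_row A"
  have A: "A \<in> carrier_mat n n" and B: "B \<in> carrier_mat n n"
    using assms by (auto simp: unitary_mat_def n_def)
  have "A * B * mat_adjoint (A * B) = A * (B * (mat_adjoint B * mat_adjoint A))"
    unfolding mat_adjoint_mult[OF A B] using A B by (intro assoc_mult_mat) auto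
  also have "B * (mat_adjoint B * mat_adjoint A) = B * mat_adjoint B * mat_adjoint A"
    using A B by (intro assoc_mult_mat[symmetric]) auto
  also have "\<dots> = mat_adjoint A"
    using assms(2) A B by (simp add: unitary_mat_def left_mult_one_mat[where nc = n])
  also have "A * \<dots> = 1\<^sub>m n"
    using assms(1) A by (simp add: unitary_mat_def)
  finally show ?thesis
    using A B by (simp add: unitary_mat_def)
qed

lemma unitary_mat_pow:
  assumes "unitary_mat A"
  shows "unitary_mat (A ^\<^sub>m k)"
  using assms by (induction k) (auto intro!: unitary_mat_mult)

lemma unitary_mat_smult:
  assumes "unitary_mat A" "cmod c = 1"
  shows "unitary_mat (c \<cdot>\<^sub>m A)"
proof -
  define n where "n = dim_row A"
  have A: "A \<in> carrier_mat n n"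
    using assms by (auto simp: unitary_mat_def n_def)
  have "c * cnj c = 1"
    using assms(2) complex_norm_square[of c] by simp
  have "(c \<cdot>\<^sub>m A) * mat_adjoint (c \<cdot>\<^sub>m A) = (c * cnj c) \<cdot>\<^sub>m (A * mat_adjoint A)"
    using A by (intro eq_matI) (auto simp: mat_adjoint_smult)
  then show ?thesis
    using assms(1) \<open>c * cnj c = 1\<close> by (auto simp: unitary_mat_def)
qed

section \<open>Kronecker products and block-diagonal matrices\<close>

text \<open>Division with remainder by \<open>b\<close> identifies \<open>{..<a * b}\<close> with
  the pairs \<open>(i, j)\<close>. This splits the summation index in a product of Kronecker
  products.\<close>

lemma sum_lessThan_mult:
  fixes f :: "nat \<Rightarrow> nat \<Rightarrow> 'a::comm_monoid_add"
  shows "(\<Sum>k<a * b. f (k div b) (k mod b)) = (\<Sum>i<a. \<Sum>j<b. f i j)"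
proof (cases "b = 0")
  case False
  have "(\<Sum>i<a. \<Sum>j<b. f i j) = (\<Sum>(i, j)\<in>{..<a} \<times> {..<b}. f i j)"
    by (rule sum.cartesian_product)
  also have "\<dots> = (\<Sum>k<a * b. f (k div b) (k mod b))"
  proof (rule sum.reindex_bij_witness[where i = "\<lambda>k. (k div b, k mod b)" and j = "\<lambda>(i, j). i * b + j"], goal_cases)
    case (2 p)
    obtain i j where p: "p = (i, j)" by force
    have "i * b + j < Suc i * b" using 2 p by simp
    also have "\<dots> \<le> a * b" using 2 p by (intro mult_right_mono) auto
    finally show ?case using p by simp
  qed (use False in \<open>auto simp: less_mult_imp_div_less\<close>)
  finally show ?thesis by simp
qed simp

lemma kron_dim [simp]:
  "dim_row (kron A B) = dim_row A * dim_row B" "dim_col (kron A B) = dim_col A * dim_col B"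
  by (simp_all add: kron_def)

lemma div_mod_bounds:
  fixes k a b :: nat
  assumes "k < a * b"
  shows "k div b < a" "k mod b < b"
proof -
  have "b > 0" using assms by (cases b) auto
  then show "k div b < a" "k mod b < b"
    using assms by (auto simp: less_mult_imp_div_less)
qed

lemma kron_index:
  "i < dim_row A * dim_row B \<Longrightarrow> j < dim_col A * dim_col B \<Longrightarrow>
    kron A B $$ (i, j) = A $$ (i div dim_row B, j div dim_col B) * B $$ (i mod dim_row B, j mod dim_col B)"
  by (simp add: kron_def)

text \<open>The mixed-product rule, which reduces unitarity of \<open>kron A B\<close> to that of
  its factors: over index pairs the sum for an entry factors into two independent sums.\<close>

lemma kron_mult:
  assumes "dim_col A = dim_row C" "dim_col B = dim_row D"
  shows "kron A B * kron C D = kron (A * C) (B * D)"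
proof (rule eq_matI)
  fix i j assume "i < dim_row (kron (A * C) (B * D))" "j < dim_col (kron (A * C) (B * D))"
  then have i: "i < dim_row A * dim_row B" and j: "j < dim_col C * dim_col D"
    by simp_all
  note bounds = div_mod_bounds[OF i] div_mod_bounds[OF j]
  have "(kron A B * kron C D) $$ (i, j) = (\<Sum>k<dim_row C * dim_row D.
      A $$ (i div dim_row B, k div dim_row D) * B $$ (i mod dim_row B, k mod dim_row D) *
      (C $$ (k div dim_row D, j div dim_col D) * D $$ (k mod dim_row D, j mod dim_col D)))"
    using i j assms by (auto simp: scalar_prod_def kron_index lessThan_atLeast0 intro!: sum.cong)
  also have "\<dots> = (\<Sum>p<dim_row C. \<Sum>q<dim_row D.
      (A $$ (i div dim_row B, p) * C $$ (p, j div dim_col D)) *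
      (B $$ (i mod dim_row B, q) * D $$ (q, j mod dim_col D)))"
    by (subst sum_lessThan_mult[symmetric]) (simp add: ac_simps)
  also have "\<dots> = kron (A * C) (B * D) $$ (i, j)"
    using i j bounds assms
    by (simp add: kron_index scalar_prod_def sum_product lessThan_atLeast0)
  finally show "(kron A B * kron C D) $$ (i, j) = kron (A * C) (B * D) $$ (i, j)" .
qed simp_all

lemma mat_adjoint_kron: "mat_adjoint (kron A B) = kron (mat_adjoint A) (mat_adjoint B)"
  by (rule eq_matI) (auto simp: kron_index div_mod_bounds)

lemma kron_one: "kron (1\<^sub>m a) (1\<^sub>m b) = 1\<^sub>m (a * b)"
proof (rule eq_matI)
  fix i j assume "i < dim_row (1\<^sub>m (a * b) :: complex mat)" "j < dim_col (1\<^sub>m (a * b) :: complex mat)"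
  then have i: "i < a * b" and j: "j < a * b"
    by simp_all
  have "i = j \<longleftrightarrow> i div b = j div b \<and> i mod b = j mod b"
    by (metis div_mult_mod_eq)
  then show "kron (1\<^sub>m a) (1\<^sub>m b) $$ (i, j) = 1\<^sub>m (a * b) $$ (i, j)"
    using i j div_mod_bounds[OF i] div_mod_bounds[OF j] by (auto simp: kron_index)
qed simp_all

lemma unitary_mat_kron:
  assumes "unitary_mat A" "unitary_mat B"
  shows "unitary_mat (kron A B)"
  using assms by (simp add: unitary_mat_def mat_adjoint_kron kron_mult kron_one)

lemma unitary_mat_kron_list:
  assumes "\<And>A. A \<in> set As \<Longrightarrow> unitary_mat A"
  shows "unitary_mat (kron_list As)"
  using assms by (induction As) (auto simp: kron_list_def intro!: unitary_mat_kron)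

text \<open>Induction on the blocks: the head block and the rest form a two-by-two block matrix with
  zero off-diagonal blocks, which is multiplied by its adjoint blockwise.\<close>

lemma unitary_mat_diag_block:
  assumes "\<And>A. A \<in> set As \<Longrightarrow> unitary_mat A"
  shows "unitary_mat (diag_block_mat As)"
  using assms
proof (induction As)
  case Nil
  then show ?case
    by (auto simp: unitary_mat_def intro!: eq_matI)
next
  case (Cons A As)
  define B where "B = diag_block_mat As"
  define a b where "a = dim_row A" and "b = dim_row B"
  have uA: "unitary_mat A" and uB: "unitary_mat B"
    using Cons by (auto simp: B_def)
  then have A: "A \<in> carrier_mat a a" and B: "B \<in> carrier_mat b b"
    by (auto simp: unitary_mat_def a_def b_def)
  have eq: "diag_block_mat (A # As) = four_block_mat A (0\<^sub>m a b) (0\<^sub>m b a) B"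
    using A B by (simp add: B_def[symmetric] Let_def)
  have "mat_adjoint (four_block_mat A (0\<^sub>m a b) (0\<^sub>m b a) B) =
      four_block_mat (mat_adjoint A) (0\<^sub>m a b) (0\<^sub>m b a) (mat_adjoint B)"
    using A B by (intro eq_matI) auto
  moreover have "four_block_mat A (0\<^sub>m a b) (0\<^sub>m b a) B *
      four_block_mat (mat_adjoint A) (0\<^sub>m a b) (0\<^sub>m b a) (mat_adjoint B) =
      four_block_mat (A * mat_adjoint A) (0\<^sub>m a b) (0\<^sub>m b a) (B * mat_adjoint B)"
    using A B by (subst mult_four_block_mat[where ?nr1.0 = a and ?nr2.0 = b and ?n1.0 = a and ?n2.0 = b and ?nc1.0 = a and ?nc2.0 = b]) auto
  moreover have "A * mat_adjoint A = 1\<^sub>m a" "B * mat_adjoint B = 1\<^sub>m b"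
    using uA uB by (simp_all add: unitary_mat_def a_def b_def)
  ultimately show ?case
    unfolding eq using A B by (simp add: unitary_mat_def)
qed

section \<open>The matrices P, Q, R and the generators\<close>

lemma cmod_omega [simp]: "cmod (omega m) = 1"
proof -
  have "omega m = cis (2 * pi / m)"
    by (simp add: omega_def cis_conv_exp field_simps)
  then show ?thesis
    by simp
qed

lemma omega_power: "m \<ge> 1 \<Longrightarrow> omega m ^ m = 1"
  by (simp add: omega_def flip: exp_of_nat_mult)

text \<open>The common shape of \<open>P_mat\<close> and \<open>Q_mat\<close> is a cyclic shift with
  unimodular weights. Each row has a single nonzero entry, and distinct rows have it in distinct
  columns.\<close>

lemma unitary_mat_cyclic:
  assumes "\<And>j. j \<in> {1..n} \<Longrightarrow> cmod (f j) = 1"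
  shows "unitary_mat (mat1 n (\<lambda>j k. if k = j + 1 then f j else if j = n \<and> k = 1 then f n else 0))"
proof -
  define A where "A = mat1 n (\<lambda>j k. if k = j + 1 then f j else if j = n \<and> k = 1 then f n else 0)"
  have A: "A \<in> carrier_mat n n"
    by (simp add: A_def mat1_def)
  \<comment> \<open>With indices from 0, the superdiagonal and the corner entry merge into the
    single column \<open>Suc i mod n\<close>.\<close>
  have idx: "A $$ (i, j) = (if j = Suc i mod n then f (Suc i) else 0)" if "i < n" "j < n" for i j
    using that by (auto simp: A_def mat1_def mod_Suc)
  have "A * mat_adjoint A = 1\<^sub>m n"
  proof (rule eq_matI)
    fix i j assume "i < dim_row (1\<^sub>m n :: complex mat)" "j < dim_col (1\<^sub>m n :: complex mat)"
    then have i: "i < n" and j: "j < n" by simp_all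
    have "(A * mat_adjoint A) $$ (i, j) = (\<Sum>k<n. A $$ (i, k) * cnj (A $$ (j, k)))"
      using i j A by (simp add: scalar_prod_def lessThan_atLeast0)
    also have "\<dots> = (\<Sum>k<n. if k = Suc i mod n then
        (if k = Suc j mod n then f (Suc i) * cnj (f (Suc j)) else 0) else 0)"
      using i j by (intro sum.cong) (auto simp: idx)
    also have "\<dots> = (if Suc i mod n = Suc j mod n then f (Suc i) * cnj (f (Suc j)) else 0)"
      using i by (subst sum.delta) auto
    \<comment> \<open>Cyclic succession is injective below \<open>n\<close>, so only equal rows
      meet, and then the product is the square of \<open>cmod (f (Suc i))\<close>.\<close>
    also have "\<dots> = (if i = j then 1 else 0)"
      using i j assms[of "Suc i"] complex_norm_square[of "f (Suc i)"]
      by (auto simp: mod_Suc split: if_splits)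
    finally show "(A * mat_adjoint A) $$ (i, j) = 1\<^sub>m n $$ (i, j)"
      using i j by simp
  qed (use A in auto)
  then show ?thesis
    using A by (auto simp: unitary_mat_def A_def)
qed

lemma unitary_mat_P: "unitary_mat (P_mat m)"
  unfolding P_mat_def by (rule unitary_mat_cyclic) simp

context
  fixes m :: nat and \<zeta> :: complex
  assumes m: "m \<ge> 1" and \<zeta>: "even m \<Longrightarrow> cmod \<zeta> = 1"
begin

lemma unitary_mat_Q: "unitary_mat (Q_mat m \<zeta>)"
proof (cases "odd m")
  case True
  \<comment> \<open>For odd \<open>m\<close> the corner entry 1 equals \<open>omega m ^ m\<close>,
    so the weights \<open>omega m ^ j\<close> cover it as well.\<close>
  have "Q_mat m \<zeta> = mat1 m (\<lambda>j k. if k = j + 1 then omega m ^ j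
      else if j = m \<and> k = 1 then omega m ^ m else 0)"
    using True omega_power[OF m] by (simp add: Q_mat_def cong: if_cong)
  also have "unitary_mat \<dots>"
    by (rule unitary_mat_cyclic) (simp add: norm_power)
  finally show ?thesis .
next
  case False
  have "unitary_mat (mat1 m (\<lambda>j k. if k = j + 1 then \<zeta> ^ (2 * j - 1)
      else if j = m \<and> k = 1 then \<zeta> ^ (2 * m - 1) else 0))"
    by (rule unitary_mat_cyclic) (use False \<zeta> in \<open>simp add: norm_power\<close>)
  then show ?thesis
    using False by (simp add: Q_mat_def)
qed

lemma unitary_mat_R: "unitary_mat (R_mat m \<zeta>)"
proof -
  have "unitary_mat (P_mat m ^\<^sub>m (m - 1) * Q_mat m \<zeta>)"
    by (intro unitary_mat_mult unitary_mat_pow unitary_mat_P unitary_mat_Q)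
       (simp add: P_mat_def Q_mat_def mat1_def)
  then show ?thesis
    using \<zeta> by (auto simp: R_mat_def intro: unitary_mat_smult)
qed

lemma unitary_mat_beta_even: "unitary_mat (beta_even m \<zeta> h i)"
  unfolding beta_even_def
  by (auto intro!: unitary_mat_kron_list simp: unitary_mat_P unitary_mat_Q unitary_mat_R)

lemma unitary_mat_beta_gen: "unitary_mat (beta_gen m \<zeta> d i)"
proof -
  have "unitary_mat (beta_odd m \<zeta> d i)"
    unfolding beta_odd_def
    by (auto intro!: unitary_mat_kron_list simp: unitary_mat_R unitary_mat_beta_even)
  then show ?thesis
    unfolding beta_gen_def
    by (auto intro!: unitary_mat_diag_block unitary_mat_smult simp: unitary_mat_beta_even norm_power)
qed

end

section \<open>The monomial basis\<close>

definition word :: "nat list \<Rightarrow> nat list \<Rightarrow> complex"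
  where "word w = (\<lambda>v. if v = w then 1 else 0)"

lemma free_alg_add: "f \<oplus>\<^bsub>free_alg d\<^esub> g = (\<lambda>w. f w + g w)"
  by (simp add: free_alg_def)

lemma free_alg_zero: "\<zero>\<^bsub>free_alg d\<^esub> = (\<lambda>w. 0)"
  by (simp add: free_alg_def)

lemma free_alg_one: "\<one>\<^bsub>free_alg d\<^esub> = word []"
  by (simp add: free_alg_def word_def)

lemma free_alg_mult: "f \<otimes>\<^bsub>free_alg d\<^esub> g = (\<lambda>w. \<Sum>k\<le>length w. f (take k w) * g (drop k w))"
  by (simp add: free_alg_def)

lemma free_algI:
  "finite {w. f w \<noteq> 0} \<Longrightarrow> (\<And>w. f w \<noteq> 0 \<Longrightarrow> set w \<subseteq> {1..d}) \<Longrightarrow> f \<in> carrier (free_alg d)"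
  by (simp add: free_alg_def)

lemma free_algD:
  assumes "f \<in> carrier (free_alg d)"
  shows "finite {w. f w \<noteq> 0}" "f w \<noteq> 0 \<Longrightarrow> set w \<subseteq> {1..d}"
  using assms by (simp_all add: free_alg_def)

lemma free_alg_smult_closed:
  assumes "f \<in> carrier (free_alg d)"
  shows "(\<lambda>w. c * f w) \<in> carrier (free_alg d)"
proof (rule free_algI)
  show "finite {w. c * f w \<noteq> 0}"
    by (rule finite_subset[OF _ free_algD(1)[OF assms]]) auto
qed (use free_algD(2)[OF assms] in auto)

lemma free_alg_sum_closed:
  assumes "\<And>x. x \<in> A \<Longrightarrow> f x \<in> carrier (free_alg d)"
  shows "(\<lambda>w. \<Sum>x\<in>A. f x w) \<in> carrier (free_alg d)"
proof -
  interpret F: ring "free_alg d" by (rule free_alg_ring)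
  show ?thesis
    using assms
    by (induction A rule: infinite_finite_induct)
       (use F.zero_closed F.a_closed in \<open>auto simp: free_alg_zero free_alg_add\<close>)
qed

lemma free_alg_finsum:
  assumes "\<And>x. x \<in> A \<Longrightarrow> f x \<in> carrier (free_alg d)"
  shows "finsum (free_alg d) f A = (\<lambda>w. \<Sum>x\<in>A. f x w)"
proof -
  interpret F: ring "free_alg d" by (rule free_alg_ring)
  show ?thesis
    using assms
    by (induction A rule: infinite_finite_induct)
       (auto simp: free_alg_zero free_alg_add F.finsum_infinite)
qed

lemma free_alg_uminus:
  assumes "f \<in> carrier (free_alg d)"
  shows "\<ominus>\<^bsub>free_alg d\<^esub> f = (\<lambda>w. - f w)"
proof -
  interpret F: ring "free_alg d" by (rule free_alg_ring)
  have "(\<lambda>w. - f w) \<in> carrier (free_alg d)"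
    using free_alg_smult_closed[OF assms, of "-1"] by simp
  then show ?thesis
    using assms by (intro F.minus_equality) (auto simp: free_alg_zero free_alg_add)
qed

lemma free_alg_minus:
  assumes "g \<in> carrier (free_alg d)"
  shows "f \<ominus>\<^bsub>free_alg d\<^esub> g = (\<lambda>w. f w - g w)"
  using assms by (simp add: a_minus_def free_alg_uminus free_alg_add)

lemma word_closed [simp]: "set w \<subseteq> {1..d} \<Longrightarrow> word w \<in> carrier (free_alg d)"
  by (rule free_algI) (auto simp: word_def split: if_splits)

lemma free_scalar_closed [simp]: "free_scalar c \<in> carrier (free_alg d)"
  by (rule free_algI) (auto simp: free_scalar_def split: if_splits)

lemma free_gen_eq_word: "free_gen j = word [j]"
  by (simp add: free_gen_def word_def)

text \<open>Only the empty prefix lies in the support of \<open>free_scalar c\<close>. This makes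
  \<open>gca_scale\<close> act on a representative by pointwise scaling.\<close>

lemma free_scalar_mult: "free_scalar c \<otimes>\<^bsub>free_alg d\<^esub> f = (\<lambda>w. c * f w)"
proof
  fix w
  have "(\<Sum>k\<le>length w. free_scalar c (take k w) * f (drop k w)) =
      (\<Sum>k\<le>length w. if k = 0 then c * f w else 0)"
    by (intro sum.cong) (auto simp: free_scalar_def)
  then show "(free_scalar c \<otimes>\<^bsub>free_alg d\<^esub> f) w = c * f w"
    by (simp add: free_alg_mult)
qed

lemma free_alg_smult_mult:
  "(\<lambda>w. c * f w) \<otimes>\<^bsub>free_alg d\<^esub> g = (\<lambda>w. c * (f \<otimes>\<^bsub>free_alg d\<^esub> g) w)"
  "f \<otimes>\<^bsub>free_alg d\<^esub> (\<lambda>w. c * g w) = (\<lambda>w. c * (f \<otimes>\<^bsub>free_alg d\<^esub> g) w)"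
  by (simp_all add: free_alg_mult sum_distrib_left mult_ac)

lemma word_mult: "word u \<otimes>\<^bsub>free_alg d\<^esub> word v = word (u @ v)"
proof
  fix w
  have "(\<Sum>k\<le>length w. word u (take k w) * word v (drop k w)) =
      (\<Sum>k\<le>length w. if k = length u then (if w = u @ v then 1 else 0) else 0)"
  proof (intro sum.cong refl)
    fix k assume "k \<in> {..length w}"
    then have "length (take k w) = k"
      by simp
    \<comment> \<open>A splitting of \<open>w\<close> is fixed by its cut position, so only the cut
      at \<open>length u\<close> can contribute.\<close>
    then have "take k w = u \<and> drop k w = v \<longleftrightarrow> k = length u \<and> w = u @ v"
      by (metis append_take_drop_id append_eq_conv_conj)
    moreover have "word u (take k w) * word v (drop k w) =
        (if take k w = u \<and> drop k w = v then 1 else 0)"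
      by (simp add: word_def)
    ultimately show "word u (take k w) * word v (drop k w) =
        (if k = length u then if w = u @ v then 1 else 0 else 0)"
      by simp
  qed
  then show "(word u \<otimes>\<^bsub>free_alg d\<^esub> word v) w = word (u @ v) w"
    by (auto simp: free_alg_mult word_def)
qed

lemma free_gen_pow: "free_gen j [^]\<^bsub>free_alg d\<^esub> (n :: nat) = word (replicate n j)"
proof -
  interpret F: ring "free_alg d" by (rule free_alg_ring)
  show ?thesis
  proof (induction n)
    case (Suc n)
    then show ?case
      by (simp add: free_gen_eq_word word_mult flip: replicate_append_same)
  qed (simp add: free_alg_one)
qed

section \<open>Residue classes and lifts of monomials\<close>

abbreviation gca_class :: "nat \<Rightarrow> nat \<Rightarrow> (nat list \<Rightarrow> complex) \<Rightarrow> (nat list \<Rightarrow> complex) set"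
  where "gca_class m d f \<equiv> gca_ideal m d +>\<^bsub>free_alg d\<^esub> f"

lemma gca_class_ring_hom: "ring_hom_ring (free_alg d) (gca m d) (gca_class m d)"
  unfolding gca_def by (rule ideal.rcos_ring_hom_ring[OF gca_ideal])

lemma gca_classE:
  assumes "U \<in> carrier (gca m d)"
  obtains f where "f \<in> carrier (free_alg d)" "U = gca_class m d f"
  using assms by (auto simp: gca_def FactRing_def A_RCOSETS_defs a_r_coset_def)

lemma gca_class_eq_iff:
  assumes "f \<in> carrier (free_alg d)" "g \<in> carrier (free_alg d)"
  shows "gca_class m d f = gca_class m d g \<longleftrightarrow> (\<lambda>w. f w - g w) \<in> gca_ideal m d"
  using ring.quotient_eq_iff_same_a_r_cos[OF free_alg_ring gca_ideal assms] assms(2)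
  by (simp add: free_alg_minus)

lemma gca_class_closed [simp]:
  "f \<in> carrier (free_alg d) \<Longrightarrow> gca_class m d f \<in> carrier (gca m d)"
  by (rule ring_hom_closed[OF ring_hom_ring.homh[OF gca_class_ring_hom]])

lemma gca_class_mult:
  assumes "f \<in> carrier (free_alg d)" "g \<in> carrier (free_alg d)"
  shows "gca_class m d f \<otimes>\<^bsub>gca m d\<^esub> gca_class m d g = gca_class m d (f \<otimes>\<^bsub>free_alg d\<^esub> g)"
  using ring_hom_mult[OF ring_hom_ring.homh[OF gca_class_ring_hom] assms] by simp

lemma gca_class_one: "\<one>\<^bsub>gca m d\<^esub> = gca_class m d (word [])"
  using ring_hom_one[OF ring_hom_ring.homh[OF gca_class_ring_hom, of d m]] by (simp add: free_alg_one)

lemma gca_class_add: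
  assumes "f \<in> carrier (free_alg d)" "g \<in> carrier (free_alg d)"
  shows "gca_class m d (\<lambda>w. f w + g w) = gca_class m d f \<oplus>\<^bsub>gca m d\<^esub> gca_class m d g"
  using ring_hom_add[OF ring_hom_ring.homh[OF gca_class_ring_hom] assms] by (simp add: free_alg_add)

lemma gca_scale_class:
  assumes "f \<in> carrier (free_alg d)"
  shows "gca_scale m d c (gca_class m d f) = gca_class m d (\<lambda>w. c * f w)"
  using assms by (simp add: gca_scale_def gca_class_mult free_scalar_mult)

lemma gca_scale_closed:
  assumes "U \<in> carrier (gca m d)"
  shows "gca_scale m d c U \<in> carrier (gca m d)"
proof -
  interpret G: ring "gca m d" by (rule gca_ring)
  show ?thesis
    using assms by (simp add: gca_scale_def)
qed

lemma gca_gen_eq: "gca_gen m d j = gca_class m d (word [j])"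
  by (simp add: gca_gen_def free_gen_eq_word)

lemma gca_gen_pow:
  assumes "j \<in> {1..d}"
  shows "gca_gen m d j [^]\<^bsub>gca m d\<^esub> (n :: nat) = gca_class m d (word (replicate n j))"
proof -
  have "free_gen j \<in> carrier (free_alg d)"
    using assms by (simp add: free_gen_eq_word)
  from ring_hom_ring.hom_nat_pow[OF gca_class_ring_hom this, of m n] show ?thesis
    by (simp add: gca_gen_def free_gen_pow)
qed

text \<open>A single word that represents the monomial with exponents \<open>J\<close>. The
  exponents are unbounded here, since sorting a word yields letter counts that are reduced modulo
  \<open>m\<close> only afterwards.\<close>

definition monom_word :: "nat \<Rightarrow> (nat \<Rightarrow> nat) \<Rightarrow> nat list"
  where "monom_word d J = concat (map (\<lambda>i. replicate (J i) i) [1..<d+1])"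

lemma set_monom_word: "set (monom_word d J) \<subseteq> {1..d}"
  by (auto simp: monom_word_def split: if_splits)

lemma gca_monom_eq: "gca_monom m d J = gca_class m d (word (monom_word d J))"
proof -
  \<comment> \<open>The claim is generalised from \<open>[1..<d+1]\<close> to an arbitrary list of
    letters, so that induction on the list applies.\<close>
  have "foldr (\<lambda>i x. (gca_gen m d i [^]\<^bsub>gca m d\<^esub> J i) \<otimes>\<^bsub>gca m d\<^esub> x) is \<one>\<^bsub>gca m d\<^esub> =
      gca_class m d (word (concat (map (\<lambda>i. replicate (J i) i) is)))"
    if "set is \<subseteq> {1..d}" for "is"
    using that
  proof (induction "is")
    case (Cons i "is")
    then have "set (replicate (J i) i) \<subseteq> {1..d}"
        "set (concat (map (\<lambda>i. replicate (J i) i) is)) \<subseteq> {1..d}"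
      by (auto split: if_splits)
    with Cons show ?case
      by (simp add: gca_gen_pow gca_class_mult word_mult)
  qed (simp add: gca_class_one)
  moreover have "set [1..<d+1] \<subseteq> {1..d}"
    by auto
  ultimately show ?thesis
    unfolding gca_monom_def monom_word_def by blast
qed

lemma finite_multi_indices: "finite (multi_indices m d)"
  by (simp add: multi_indices_def finite_PiE)

lemma free_comb_closed:
  "(\<lambda>w. \<Sum>J\<in>A. u J * word (monom_word d J) w) \<in> carrier (free_alg d)"
  by (intro free_alg_sum_closed free_alg_smult_closed word_closed set_monom_word)

text \<open>A combination of monomials is the class of one explicit element of the free algebra, so
  spanning and independence can both be argued with representatives.\<close>

lemma gca_comb_eq:
  "(\<Oplus>\<^bsub>gca m d\<^esub>J\<in>A. gca_scale m d (u J) (gca_monom m d J)) =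
    gca_class m d (\<lambda>w. \<Sum>J\<in>A. u J * word (monom_word d J) w)"
proof -
  have closed: "(\<lambda>w. u J * word (monom_word d J) w) \<in> carrier (free_alg d)" for J
    by (intro free_alg_smult_closed word_closed set_monom_word)
  have "gca_class m d (finsum (free_alg d) (\<lambda>J w. u J * word (monom_word d J) w) A) =
      (\<Oplus>\<^bsub>gca m d\<^esub>J\<in>A. gca_class m d (\<lambda>w. u J * word (monom_word d J) w))"
    using closed by (subst ring_hom_ring.hom_finsum[OF gca_class_ring_hom]) (auto simp: o_def)
  moreover have "gca_scale m d (u J) (gca_monom m d J) = gca_class m d (\<lambda>w. u J * word (monom_word d J) w)" for J
    by (simp add: gca_monom_eq gca_scale_class word_closed[OF set_monom_word])
  ultimately show ?thesis
    using closed by (simp add: free_alg_finsum)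
qed

section \<open>Spanning: rewriting words to monomials\<close>

text \<open>Rewriting in the quotient up to an unspecified scalar: spanning asks only that some
  coefficient exists, so the powers of \<omega> are not tracked.\<close>

definition reduces :: "nat \<Rightarrow> nat \<Rightarrow> nat list \<Rightarrow> nat list \<Rightarrow> bool"
  where "reduces m d w v \<longleftrightarrow> (\<exists>c. gca_class m d (word w) = gca_class m d (\<lambda>x. c * word v x))"

lemma reduces_refl [simp]: "reduces m d w w"
  unfolding reduces_def by (rule exI[where x = 1]) simp

lemma gca_class_smult_cong:
  assumes "gca_class m d f = gca_class m d g"
    and "f \<in> carrier (free_alg d)" "g \<in> carrier (free_alg d)"
  shows "gca_class m d (\<lambda>w. c * f w) = gca_class m d (\<lambda>w. c * g w)"
  using gca_scale_class assms by metis

lemma reduces_trans: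
  assumes "reduces m d u v" "reduces m d v w"
    and "set v \<subseteq> {1..d}" "set w \<subseteq> {1..d}"
  shows "reduces m d u w"
proof -
  from assms obtain a b where a: "gca_class m d (word u) = gca_class m d (\<lambda>x. a * word v x)"
    and b: "gca_class m d (word v) = gca_class m d (\<lambda>x. b * word w x)"
    by (auto simp: reduces_def)
  have "gca_class m d (\<lambda>x. a * word v x) = gca_class m d (\<lambda>x. a * (b * word w x))"
    by (rule gca_class_smult_cong[OF b]) (use assms in \<open>auto intro: free_alg_smult_closed\<close>)
  with a show ?thesis
    by (auto simp: reduces_def simp flip: mult.assoc)
qed

text \<open>Scalars are central, so rewriting may be applied to any factor of a word.\<close>

lemma reduces_append:
  assumes "reduces m d w v" "reduces m d w' v'"
    and "set w \<subseteq> {1..d}" "set v \<subseteq> {1..d}" "set w' \<subseteq> {1..d}" "set v' \<subseteq> {1..d}"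
  shows "reduces m d (w @ w') (v @ v')"
proof -
  from assms obtain a b where a: "gca_class m d (word w) = gca_class m d (\<lambda>x. a * word v x)"
    and b: "gca_class m d (word w') = gca_class m d (\<lambda>x. b * word v' x)"
    by (auto simp: reduces_def)
  have "gca_class m d (word (w @ w')) = gca_class m d (word w) \<otimes>\<^bsub>gca m d\<^esub> gca_class m d (word w')"
    using assms by (simp add: gca_class_mult word_mult)
  also have "\<dots> = gca_class m d (\<lambda>x. a * b * word (v @ v') x)"
    unfolding a b using assms
    by (simp add: gca_class_mult free_alg_smult_closed free_alg_smult_mult word_mult mult_ac)
  finally show ?thesis
    by (auto simp: reduces_def)
qed

lemma gca_ideal_relator: "f \<in> gca_relators m d \<Longrightarrow> f \<in> gca_ideal m d"
  unfolding gca_ideal_def using ring.genideal_self[OF free_alg_ring gca_relators_subset] by blast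

lemma gca_class_power:
  assumes "j \<in> {1..d}"
  shows "gca_class m d (word (replicate m j)) = gca_class m d (word [])"
proof -
  have "free_gen j [^]\<^bsub>free_alg d\<^esub> m \<ominus>\<^bsub>free_alg d\<^esub> \<one>\<^bsub>free_alg d\<^esub> \<in> gca_ideal m d"
    by (rule gca_ideal_relator) (use assms in \<open>unfold gca_relators_def, blast\<close>)
  moreover have "set (replicate m j) \<subseteq> {1..d}"
    using assms by auto
  ultimately show ?thesis
    by (subst gca_class_eq_iff) (simp_all only: free_gen_pow free_alg_one free_alg_minus word_closed list.set empty_subsetI)
qed

lemma gca_class_commute:
  assumes "k \<in> {1..d}" "l \<in> {1..d}" "k < l"
  shows "gca_class m d (word [k, l]) = gca_class m d (\<lambda>x. omega m * word [l, k] x)"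
proof -
  have "free_gen k \<otimes>\<^bsub>free_alg d\<^esub> free_gen l \<ominus>\<^bsub>free_alg d\<^esub>
      free_scalar (omega m) \<otimes>\<^bsub>free_alg d\<^esub> (free_gen l \<otimes>\<^bsub>free_alg d\<^esub> free_gen k) \<in> gca_ideal m d"
    by (rule gca_ideal_relator) (use assms in \<open>unfold gca_relators_def, blast\<close>)
  moreover have "(\<lambda>x. omega m * word [l, k] x) \<in> carrier (free_alg d)"
    using assms by (intro free_alg_smult_closed) auto
  ultimately show ?thesis
    using assms by (subst gca_class_eq_iff)
      (auto simp: free_gen_eq_word word_mult free_scalar_mult free_alg_minus)
qed

text \<open>The relation \<open>e_k e_l = \<omega> e_l e_k\<close>, read from right to left, costs
  the factor \<open>inverse (omega m)\<close>.\<close>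

lemma reduces_swap:
  assumes "k \<in> {1..d}" "l \<in> {1..d}" "k < l"
  shows "reduces m d [l, k] [k, l]"
proof -
  have "omega m \<noteq> 0" by (simp add: omega_def)
  have "gca_class m d (\<lambda>x. inverse (omega m) * word [k, l] x) =
      gca_class m d (\<lambda>x. inverse (omega m) * (omega m * word [l, k] x))"
    by (rule gca_class_smult_cong[OF gca_class_commute])
       (use assms in \<open>auto intro: free_alg_smult_closed\<close>)
  also have "\<dots> = gca_class m d (word [l, k])"
    using \<open>omega m \<noteq> 0\<close> by (simp flip: mult.assoc)
  finally show ?thesis
    unfolding reduces_def by metis
qed

text \<open>One pass of insertion sort: \<open>k\<close> moves right past smaller letters, one swap
  relation at a time.\<close>

lemma reduces_insort:
  assumes "k \<in> {1..d}" "set w \<subseteq> {1..d}"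
  shows "reduces m d (k # w) (insort k w)"
  using assms(2)
proof (induction w)
  case (Cons x w)
  show ?case
  proof (cases "k \<le> x")
    case False
    then have "reduces m d ([k, x] @ w) ([x, k] @ w)"
      using Cons assms by (intro reduces_append reduces_swap) auto
    moreover have "reduces m d ([x] @ (k # w)) ([x] @ insort k w)"
      using Cons assms by (intro reduces_append) (auto simp: set_insort_key)
    ultimately have "reduces m d (k # x # w) (x # insort k w)"
      using Cons.prems assms(1) by (auto simp: set_insort_key elim!: reduces_trans[of m d "k # x # w" "x # k # w"])
    with False show ?thesis
      by simp
  qed simp
qed simp

lemma reduces_sort:
  assumes "set w \<subseteq> {1..d}"
  shows "reduces m d w (sort w)"
  using assms
proof (induction w)
  case (Cons x w)
  have "reduces m d ([x] @ w) ([x] @ sort w)"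
    using Cons by (intro reduces_append) auto
  moreover have "reduces m d (x # sort w) (sort (x # w))"
    using reduces_insort[of x d "sort w"] Cons.prems by simp
  ultimately show ?case
    using Cons.prems by (auto simp: set_insort_key elim!: reduces_trans[of m d "x # w" "x # sort w"])
qed simp

lemma count_list_concat_replicate:
  assumes "distinct is"
  shows "count_list (concat (map (\<lambda>i. replicate (J i) i) is)) i = (if i \<in> set is then J i else 0)"
proof -
  have "count_list (replicate n j) i = (if i = j then n else 0)" for n j
    by (induction n) auto
  then show ?thesis
    using assms by (induction "is") auto
qed

lemma count_list_monom_word: "count_list (monom_word d J) i = (if i \<in> {1..d} then J i else 0)"
  unfolding monom_word_def by (subst count_list_concat_replicate) auto

lemma sorted_monom_word: "sorted (monom_word d J)"
proof -
  have "sorted (concat (map (\<lambda>i. replicate (J i) i) is))" if "sorted is" for "is"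
    using that by (induction "is") (auto simp: sorted_append split: if_splits)
  then show ?thesis
    unfolding monom_word_def by (meson sorted_upt)
qed

text \<open>A sorted word is determined by the multiset of its letters.\<close>

lemma sort_eq_monom_word:
  assumes "set w \<subseteq> {1..d}"
  shows "sort w = monom_word d (count_list w)"
proof (rule properties_for_sort)
  have "count (mset (monom_word d (count_list w))) i = count (mset w) i" for i
    using assms by (auto simp: count_mset count_list_monom_word count_list_0_iff)
  then show "mset (monom_word d (count_list w)) = mset w"
    by (rule multiset_eqI)
qed (rule sorted_monom_word)

lemma reduces_replicate:
  assumes "j \<in> {1..d}"
  shows "reduces m d (replicate n j) (replicate (n mod m) j)"
proof -
  \<comment> \<open>Here \<open>q\<close> counts the blocks of \<open>m\<close> equal letters, each
    of which is removed by \<open>e_j^m = e\<close>.\<close>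
  have "reduces m d (replicate (q * m + r) j) (replicate r j)" for q r
  proof (induction q)
    case (Suc q)
    have "reduces m d (replicate m j) []"
      unfolding reduces_def using gca_class_power[OF assms, of m] by (intro exI[where x = 1]) simp
    then have "reduces m d (replicate m j @ replicate (q * m + r) j) ([] @ replicate r j)"
      using Suc assms by (intro reduces_append) auto
    then show ?case
      by (simp add: replicate_add add.assoc)
  qed simp
  from this[of "n div m" "n mod m"] show ?thesis
    by simp
qed

lemma reduces_monom_word:
  "reduces m d (monom_word d J) (monom_word d (\<lambda>i. J i mod m))"
proof -
  have "reduces m d (concat (map (\<lambda>i. replicate (J i) i) is))
      (concat (map (\<lambda>i. replicate (J i mod m) i) is))" if "set is \<subseteq> {1..d}" for "is"
    using that
  proof (induction "is")
    case (Cons i "is")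
    then show ?case
      by (auto intro!: reduces_append reduces_replicate simp: subset_iff split: if_splits)
  qed simp
  moreover have "set [1..<d+1] \<subseteq> {1..d}"
    by auto
  ultimately show ?thesis
    unfolding monom_word_def by blast
qed

lemma monom_word_restrict: "monom_word d (restrict J {1..d}) = monom_word d J"
  unfolding monom_word_def by (intro arg_cong[where f = concat] map_cong) auto

lemma reduces_monom:
  assumes "m \<ge> 1" "set w \<subseteq> {1..d}"
  obtains J where "J \<in> multi_indices m d" "reduces m d w (monom_word d J)"
proof
  \<comment> \<open>Exponents are the letter counts modulo \<open>m\<close>; \<open>restrict\<close>
    makes them extensional, as \<open>multi_indices\<close> demands.\<close>
  let ?J = "restrict (\<lambda>i. count_list w i mod m) {1..d}"
  have "n mod m \<le> m - 1" for n
    using assms(1) mod_less_divisor[of m n] by linarith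
  then show "?J \<in> multi_indices m d"
    by (auto simp: multi_indices_def)
  have "reduces m d w (monom_word d (\<lambda>i. count_list w i mod m))"
    using reduces_sort[OF assms(2)] reduces_monom_word set_monom_word
    unfolding sort_eq_monom_word[OF assms(2)] by (rule reduces_trans) (rule set_monom_word)
  then show "reduces m d w (monom_word d ?J)"
    by (simp only: monom_word_restrict)
qed

text \<open>Induction on a finite set containing the support of a representative; each word in turn
  is replaced by a multiple of its monomial.\<close>

lemma gca_comb_exists:
  assumes "m \<ge> 1" "U \<in> carrier (gca m d)"
  obtains u where "U = (\<Oplus>\<^bsub>gca m d\<^esub>J\<in>multi_indices m d. gca_scale m d (u J) (gca_monom m d J))"
proof -
  define comb where "comb u = (\<lambda>w. \<Sum>J\<in>multi_indices m d. u J * word (monom_word d J) w)" for u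
  have comb_closed: "comb u \<in> carrier (free_alg d)" for u
    unfolding comb_def by (rule free_comb_closed)
  have "\<exists>u. gca_class m d f = gca_class m d (comb u)"
    if "finite S" "f \<in> carrier (free_alg d)" "{w. f w \<noteq> 0} \<subseteq> S" for S f
    using that
  proof (induction S arbitrary: f rule: finite_induct)
    case empty
    then have "f = comb (\<lambda>_. 0)"
      by (auto simp: comb_def)
    then show ?case by blast
  next
    case (insert w S)
    \<comment> \<open>Removing \<open>w\<close> leaves an element supported in \<open>S\<close>, to
      which the induction hypothesis applies.\<close>
    define g where "g = f(w := 0)"
    have "{v. g v \<noteq> 0} \<subseteq> {v. f v \<noteq> 0}"
      by (auto simp: g_def)
    then have g: "g \<in> carrier (free_alg d)"
      using free_algD[OF insert.prems(1)] by (intro free_algI) (auto intro: finite_subset)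
    have "{v. g v \<noteq> 0} \<subseteq> S"
      using insert.prems(2) by (auto simp: g_def)
    from insert.IH[OF g this] obtain u where u: "gca_class m d g = gca_class m d (comb u)" ..
    show ?case
    proof (cases "f w = 0")
      case True
      then have "f = g" by (auto simp: g_def)
      with u show ?thesis by blast
    next
      case False
      then have w: "set w \<subseteq> {1..d}"
        by (rule free_algD(2)[OF insert.prems(1)])
      from reduces_monom[OF assms(1) w] obtain J where J: "J \<in> multi_indices m d"
        and "reduces m d w (monom_word d J)" .
      then obtain c where c: "gca_class m d (word w) = gca_class m d (\<lambda>x. c * word (monom_word d J) x)"
        by (auto simp: reduces_def)
      define t where "t = (\<lambda>x. f w * (c * word (monom_word d J) x))"
      have t: "t \<in> carrier (free_alg d)"
        unfolding t_def by (intro free_alg_smult_closed word_closed set_monom_word)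
      have "f = (\<lambda>x. g x + f w * word w x)"
        by (auto simp: g_def word_def)
      then have "gca_class m d f = gca_class m d g \<oplus>\<^bsub>gca m d\<^esub> gca_class m d (\<lambda>x. f w * word w x)"
        using g w by (subst gca_class_add[symmetric]) (auto intro: free_alg_smult_closed)
      also have "gca_class m d (\<lambda>x. f w * word w x) = gca_class m d t"
        unfolding t_def by (rule gca_class_smult_cong[OF c])
          (fact word_closed[OF w] free_alg_smult_closed[OF word_closed[OF set_monom_word]])+
      also have "gca_class m d g \<oplus>\<^bsub>gca m d\<^esub> \<dots> = gca_class m d (\<lambda>x. comb u x + t x)"
        unfolding u by (rule gca_class_add[symmetric]) (fact comb_closed t)+
      \<comment> \<open>The word \<open>w\<close> adds \<open>f w * c\<close> to the coefficient of
        the monomial with exponents \<open>J\<close>.\<close>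
      also have "(\<lambda>x. comb u x + t x) = comb (\<lambda>J'. u J' + (if J' = J then f w * c else 0))"
        using J finite_multi_indices[of m d]
        by (auto simp: comb_def t_def distrib_right sum.distrib if_distrib[of "\<lambda>a. a * _"] cong: if_cong)
      finally show ?thesis by blast
    qed
  qed
  moreover obtain f where f: "f \<in> carrier (free_alg d)" "U = gca_class m d f"
    using assms(2) by (rule gca_classE)
  ultimately obtain u where "U = gca_class m d (comb u)"
    using free_algD(1)[OF f(1)] by blast
  then show ?thesis
    by (intro that[of u]) (simp add: gca_comb_eq comb_def)
qed

section \<open>Inversions and degrees modulo m\<close>

fun inversions :: "nat list \<Rightarrow> nat"
  where "inversions [] = 0"
  | "inversions (x # w) = length (filter (\<lambda>y. y < x) w) + inversions w"

text \<open>The number of inversions between a letter of \<open>u\<close> and a letter of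
  \<open>v\<close>. It is bilinear in the letter counts, so its residue modulo \<open>m\<close>
  depends only on the degrees modulo \<open>m\<close>.\<close>

definition cross_inversions :: "nat \<Rightarrow> nat list \<Rightarrow> nat list \<Rightarrow> nat"
  where "cross_inversions d u v = (\<Sum>x\<in>{1..d}. \<Sum>y\<in>{1..<x}. count_list u x * count_list v y)"

lemma length_filter_less:
  fixes v :: "nat list"
  assumes "set v \<subseteq> {1..d}"
  shows "length (filter (\<lambda>y. y < x) v) = (\<Sum>y\<in>{1..<x}. count_list v y)"
  using assms
proof (induction v)
  case (Cons a v)
  have "(\<Sum>y\<in>{1..<x}. count_list (a # v) y) =
      (\<Sum>y\<in>{1..<x}. (if y = a then 1 else 0) + count_list v y)"
    by (intro sum.cong) auto
  with Cons show ?case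
    by (simp add: sum.distrib)
qed simp

lemma inversions_append:
  assumes "set u \<subseteq> {1..d}" "set v \<subseteq> {1..d}"
  shows "inversions (u @ v) = inversions u + inversions v + cross_inversions d u v"
  using assms(1)
proof (induction u)
  case (Cons a u)
  have "cross_inversions d (a # u) v =
      (\<Sum>x\<in>{1..d}. (if x = a then \<Sum>y\<in>{1..<x}. count_list v y else 0) +
        (\<Sum>y\<in>{1..<x}. count_list u x * count_list v y))"
    unfolding cross_inversions_def by (intro sum.cong) (auto simp: sum.distrib)
  also have "\<dots> = (\<Sum>y\<in>{1..<a}. count_list v y) + cross_inversions d u v"
    using Cons.prems by (simp add: sum.distrib cross_inversions_def)
  finally show ?case
    using Cons assms(2) by (simp add: length_filter_less)
qed (simp add: cross_inversions_def)

text \<open>The grading of words by exponent vectors modulo \<open>m\<close>; both kinds of relators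
  are homogeneous for it.\<close>

definition same_degree :: "nat \<Rightarrow> nat \<Rightarrow> nat list \<Rightarrow> nat list \<Rightarrow> bool"
  where "same_degree m d u v \<longleftrightarrow> (\<forall>i\<in>{1..d}. [count_list u i = count_list v i] (mod m))"

lemma same_degree_cross_inversions:
  assumes "same_degree m d u u'" "same_degree m d v v'"
  shows "[cross_inversions d u v = cross_inversions d u' v'] (mod m)"
  unfolding cross_inversions_def using assms
  by (intro cong_sum cong_mult) (auto simp: same_degree_def)

text \<open>Sorting \<open>w\<close> by the relations costs one factor \<open>\<omega>\<inverse> = cnj \<omega>\<close> per inversion, so the weight reads off
  the coefficient with which \<open>w\<close> contributes to the monomial of the degree of \<open>w0\<close>.\<close>

definition word_weight :: "nat \<Rightarrow> nat \<Rightarrow> nat list \<Rightarrow> nat list \<Rightarrow> complex"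
  where "word_weight m d w0 w =
    (if same_degree m d w w0 then cnj (omega m) ^ inversions w else 0)"

lemma cnj_omega_power_cong:
  assumes "m \<ge> 1" "[a = b] (mod m)"
  shows "cnj (omega m) ^ a = cnj (omega m) ^ b"
proof -
  have "cnj (omega m) ^ m = 1"
    using arg_cong[OF omega_power[OF assms(1)], of cnj] by simp
  then have "cnj (omega m) ^ (m * q + r) = cnj (omega m) ^ r" for q r
    unfolding power_add power_mult by simp
  from this[of "a div m" "a mod m" for a] have "cnj (omega m) ^ a = cnj (omega m) ^ (a mod m)" for a
    by simp
  then show ?thesis
    using assms(2) by (metis cong_def)
qed

lemma same_degree_append_cancel:
  assumes "same_degree m d (u @ v0) w"
  shows "same_degree m d (u @ v) w \<longleftrightarrow> same_degree m d v v0"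
proof -
  have "[a + b' = c] (mod m) \<longleftrightarrow> [b' = b] (mod m)" if "[a + b = c] (mod m)" for a b b' c :: nat
    using that by (metis cong_add_lcancel_nat cong_sym cong_trans)
  then show ?thesis
    using assms unfolding same_degree_def count_list_append by (intro ball_cong refl) auto
qed

lemma same_degree_append_commute: "same_degree m d (u @ v) w \<longleftrightarrow> same_degree m d (v @ u) w"
  by (simp add: same_degree_def add.commute)

text \<open>Prefixing \<open>u\<close> turns the functional of one degree into a scalar multiple of
  that of another. The scalar collects the inversions inside \<open>u\<close> and those between
  \<open>u\<close> and \<open>v\<close>; the latter are constant modulo \<open>m\<close> for
  \<open>v\<close> of the degree of \<open>v0\<close>.\<close>

lemma word_weight_append_left:
  assumes "m \<ge> 1" "set u \<subseteq> {1..d}"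
  obtains c v0 where
    "\<And>v. set v \<subseteq> {1..d} \<Longrightarrow> word_weight m d w (u @ v) = c * word_weight m d v0 v"
proof (cases "\<exists>v0. same_degree m d (u @ v0) w")
  case True
  \<comment> \<open>Any word \<open>v0\<close> completing \<open>u\<close> to the degree of
    \<open>w\<close> fixes the degree \<open>v\<close> must have for a nonzero weight.\<close>
  then obtain v0 where v0: "same_degree m d (u @ v0) w" ..
  show ?thesis
  proof (rule that[of "cnj (omega m) ^ (inversions u + cross_inversions d u v0)" v0])
    fix v assume v: "set v \<subseteq> {1..d}"
    have "cnj (omega m) ^ cross_inversions d u v = cnj (omega m) ^ cross_inversions d u v0"
      if "same_degree m d v v0"
      by (intro cnj_omega_power_cong same_degree_cross_inversions)
         (use assms that in \<open>auto simp: same_degree_def\<close>)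
    then show "word_weight m d w (u @ v) =
        cnj (omega m) ^ (inversions u + cross_inversions d u v0) * word_weight m d v0 v"
      using same_degree_append_cancel[OF v0, of v]
      by (auto simp: word_weight_def inversions_append[OF assms(2) v] power_add)
  qed
next
  case False
  \<comment> \<open>If no word completes \<open>u\<close> to the degree of \<open>w\<close>, every
    weight on the left is zero and the scalar 0 serves.\<close>
  then show ?thesis
    by (intro that[of 0]) (auto simp: word_weight_def)
qed

text \<open>The mirror image. Degrees ignore the order of the factors, so
  \<open>same_degree_append_cancel\<close> applies after swapping them; only the crossing inversions
  see the order.\<close>

lemma word_weight_append_right:
  assumes "m \<ge> 1" "set u \<subseteq> {1..d}"
  obtains c v0 where
    "\<And>v. set v \<subseteq> {1..d} \<Longrightarrow> word_weight m d w (v @ u) = c * word_weight m d v0 v"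
proof (cases "\<exists>v0. same_degree m d (v0 @ u) w")
  case True
  then obtain v0 where v0: "same_degree m d (v0 @ u) w" ..
  show ?thesis
  proof (rule that[of "cnj (omega m) ^ (inversions u + cross_inversions d v0 u)" v0])
    fix v assume v: "set v \<subseteq> {1..d}"
    have "cnj (omega m) ^ cross_inversions d v u = cnj (omega m) ^ cross_inversions d v0 u"
      if "same_degree m d v v0"
      by (intro cnj_omega_power_cong same_degree_cross_inversions)
         (use assms that in \<open>auto simp: same_degree_def\<close>)
    then show "word_weight m d w (v @ u) =
        cnj (omega m) ^ (inversions u + cross_inversions d v0 u) * word_weight m d v0 v"
      using same_degree_append_cancel[of m d u v0 w v] v0
        same_degree_append_commute[of m d u v0] same_degree_append_commute[of m d u v]
      by (auto simp: word_weight_def inversions_append[OF v assms(2)] power_add)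
  qed
next
  case False
  then show ?thesis
    by (intro that[of 0]) (auto simp: word_weight_def)
qed

section \<open>The weight functionals and their common kernel\<close>

text \<open>A function on words determines a linear functional on the free algebra; for elements of
  the carrier the sum is finite.\<close>

definition linear_ext :: "(nat list \<Rightarrow> complex) \<Rightarrow> (nat list \<Rightarrow> complex) \<Rightarrow> complex"
  where "linear_ext F f = (\<Sum>w | f w \<noteq> 0. f w * F w)"

lemma linear_ext_superset:
  assumes "finite S" "{w. f w \<noteq> 0} \<subseteq> S"
  shows "linear_ext F f = (\<Sum>w\<in>S. f w * F w)"
  unfolding linear_ext_def using assms by (intro sum.mono_neutral_left) auto

lemma linear_ext_diff:
  assumes "f \<in> carrier (free_alg d)" "g \<in> carrier (free_alg d)"
  shows "linear_ext F (\<lambda>w. f w - g w) = linear_ext F f - linear_ext F g"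
proof -
  let ?S = "{w. f w \<noteq> 0} \<union> {w. g w \<noteq> 0}"
  have "finite ?S"
    using assms by (simp add: free_algD)
  then have "linear_ext F h = (\<Sum>w\<in>?S. h w * F w)" if "h = f \<or> h = g \<or> h = (\<lambda>w. f w - g w)" for h
    using that by (intro linear_ext_superset) auto
  then show ?thesis
    by (simp add: left_diff_distrib sum_subtractf)
qed

lemma linear_ext_smult_word: "linear_ext F (\<lambda>w. c * word v w) = c * F v"
  by (subst linear_ext_superset[of "{v}"]) (auto simp: word_def split: if_splits)

lemma linear_ext_word: "linear_ext F (word v) = F v"
  using linear_ext_smult_word[of F 1 v] by simp

lemma linear_ext_mult:
  assumes "f \<in> carrier (free_alg d)" "g \<in> carrier (free_alg d)"
  shows "linear_ext F (f \<otimes>\<^bsub>free_alg d\<^esub> g) =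
    (\<Sum>u | f u \<noteq> 0. \<Sum>v | g v \<noteq> 0. f u * g v * F (u @ v))"
proof -
  let ?P = "{u. f u \<noteq> 0} \<times> {v. g v \<noteq> 0}"
  let ?S = "(\<lambda>(u, v). u @ v) ` ?P"
  have P: "finite ?P"
    using assms by (simp add: free_algD)
  \<comment> \<open>A coefficient of the product is a sum over the factorisations of
    \<open>w\<close>; pairs outside the supports contribute nothing.\<close>
  have coeff: "(f \<otimes>\<^bsub>free_alg d\<^esub> g) w = (\<Sum>(u, v)\<in>{p \<in> ?P. (case p of (u, v) \<Rightarrow> u @ v) = w}. f u * g v)" for w
  proof -
    have "(f \<otimes>\<^bsub>free_alg d\<^esub> g) w = (\<Sum>(u, v)\<in>{(u, v). u @ v = w}. f u * g v)"
      unfolding free_alg_mult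
      by (rule sum.reindex_bij_witness[where i = "\<lambda>(u, v). length u" and j = "\<lambda>k. (take k w, drop k w)"]) auto
    also have "\<dots> = (\<Sum>(u, v)\<in>{p \<in> ?P. (case p of (u, v) \<Rightarrow> u @ v) = w}. f u * g v)"
    proof (rule sum.mono_neutral_right)
      have "{(u, v). u @ v = w} \<subseteq> (\<lambda>k. (take k w, drop k w)) ` {..length w}"
      proof
        fix p assume "p \<in> {(u, v). u @ v = w}"
        then show "p \<in> (\<lambda>k. (take k w, drop k w)) ` {..length w}"
          by (intro image_eqI[where x = "length (fst p)"]) auto
      qed
      then show "finite {(u, v). u @ v = w}"
        by (rule finite_subset) simp
    qed auto
    finally show ?thesis .
  qed
  have "linear_ext F (f \<otimes>\<^bsub>free_alg d\<^esub> g) = (\<Sum>w\<in>?S. (f \<otimes>\<^bsub>free_alg d\<^esub> g) w * F w)"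
  proof (rule linear_ext_superset)
    show "{w. (f \<otimes>\<^bsub>free_alg d\<^esub> g) w \<noteq> 0} \<subseteq> ?S"
      by (auto simp: free_alg_mult elim!: free_alg_mult_nonzeroE)
  qed (use P in simp)
  also have "\<dots> = (\<Sum>w\<in>?S. \<Sum>(u, v)\<in>{p \<in> ?P. (case p of (u, v) \<Rightarrow> u @ v) = w}. f u * g v * F (u @ v))"
    unfolding coeff by (auto simp: sum_distrib_right intro!: sum.cong)
  \<comment> \<open>Each pair lies in exactly one fibre of concatenation, so the sum over all fibres
    is the sum over all pairs.\<close>
  also have "\<dots> = (\<Sum>(u, v)\<in>?P. f u * g v * F (u @ v))"
    by (rule sum.image_gen[OF P, symmetric])
  finally show ?thesis
    by (simp add: sum.cartesian_product)
qed

definition weight_kernel :: "nat \<Rightarrow> nat \<Rightarrow> (nat list \<Rightarrow> complex) set"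
  where "weight_kernel m d =
    {f \<in> carrier (free_alg d). \<forall>w. linear_ext (word_weight m d w) f = 0}"

text \<open>Multiplication by a word on either side turns each functional into a multiple of another
  one, and all of them vanish on the kernel.\<close>

lemma ideal_weight_kernel:
  assumes "m \<ge> 1"
  shows "ideal (weight_kernel m d) (free_alg d)"
proof (rule idealI[OF free_alg_ring])
  interpret F: ring "free_alg d" by (rule free_alg_ring)
  have closed: "f \<in> carrier (free_alg d)" if "f \<in> weight_kernel m d" for f
    using that by (simp add: weight_kernel_def)
  have diff: "(\<lambda>w. f w - g w) \<in> weight_kernel m d"
    if "f \<in> weight_kernel m d" "g \<in> weight_kernel m d" for f g
    using that F.minus_closed[of f g]
    by (auto simp: weight_kernel_def linear_ext_diff free_alg_minus)
  have zero: "(\<lambda>w. 0) \<in> weight_kernel m d"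
    using F.zero_closed by (simp add: weight_kernel_def free_alg_zero linear_ext_def)
  have uminus: "(\<lambda>w. - f w) \<in> weight_kernel m d" if "f \<in> weight_kernel m d" for f
    using diff[OF zero that] by simp
  show "subgroup (weight_kernel m d) (add_monoid (free_alg d))"
  proof (rule group.subgroupI[OF F.a_group])
    fix f assume f: "f \<in> weight_kernel m d"
    show "inv\<^bsub>add_monoid (free_alg d)\<^esub> f \<in> weight_kernel m d"
      using uminus[OF f] free_alg_uminus[OF closed[OF f]] by (simp only: a_inv_def)
    fix g assume "g \<in> weight_kernel m d"
    from diff[OF f uminus[OF this]] show "f \<otimes>\<^bsub>add_monoid (free_alg d)\<^esub> g \<in> weight_kernel m d"
      by (simp add: free_alg_add)
  qed (use closed zero in auto)
  fix f g assume g: "g \<in> weight_kernel m d" and f: "f \<in> carrier (free_alg d)"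
  note g' = closed[OF g]
  have vanish: "(\<Sum>v | g v \<noteq> 0. g v * word_weight m d w v) = 0" for w
    using g by (simp add: weight_kernel_def linear_ext_def)
  show "f \<otimes>\<^bsub>free_alg d\<^esub> g \<in> weight_kernel m d"
  proof -
    have "(\<Sum>v | g v \<noteq> 0. f u * g v * word_weight m d w (u @ v)) = 0" if u: "f u \<noteq> 0" for u w
    proof -
      obtain c v0 where c: "\<And>v. set v \<subseteq> {1..d} \<Longrightarrow> word_weight m d w (u @ v) = c * word_weight m d v0 v"
        using word_weight_append_left[OF assms free_algD(2)[OF f u]] by blast
      have "(\<Sum>v | g v \<noteq> 0. f u * g v * word_weight m d w (u @ v)) =
          f u * c * (\<Sum>v | g v \<noteq> 0. g v * word_weight m d v0 v)"
        unfolding sum_distrib_left using free_algD(2)[OF g'] by (intro sum.cong) (auto simp: c)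
      then show ?thesis
        by (simp add: vanish)
    qed
    then show ?thesis
      using f g' by (simp add: weight_kernel_def linear_ext_mult free_alg_mult_closed)
  qed
  show "g \<otimes>\<^bsub>free_alg d\<^esub> f \<in> weight_kernel m d"
  proof -
    have "(\<Sum>v | g v \<noteq> 0. g v * f u * word_weight m d w (v @ u)) = 0" if u: "f u \<noteq> 0" for u w
    proof -
      obtain c v0 where c: "\<And>v. set v \<subseteq> {1..d} \<Longrightarrow> word_weight m d w (v @ u) = c * word_weight m d v0 v"
        using word_weight_append_right[OF assms free_algD(2)[OF f u]] by blast
      have "(\<Sum>v | g v \<noteq> 0. g v * f u * word_weight m d w (v @ u)) =
          f u * c * (\<Sum>v | g v \<noteq> 0. g v * word_weight m d v0 v)"
        unfolding sum_distrib_left using free_algD(2)[OF g'] by (intro sum.cong) (auto simp: c)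
      then show ?thesis
        by (simp add: vanish)
    qed
    \<comment> \<open>The swap moves the sum over the support of \<open>g\<close> inside, where it
      vanishes for each word \<open>u\<close> of \<open>f\<close>.\<close>
    then have "linear_ext (word_weight m d w) (g \<otimes>\<^bsub>free_alg d\<^esub> f) = 0" for w
      unfolding linear_ext_mult[OF g' f] by (subst sum.swap) simp
    then show ?thesis
      using f g' by (simp add: weight_kernel_def free_alg_mult_closed)
  qed
qed

text \<open>By minimality of the generated ideal only the relators have to be checked. The word of
  \<open>e_j^m\<close> has no inversions and the degree of the empty word modulo
  \<open>m\<close>.\<close>

lemma gca_ideal_subset_weight_kernel:
  assumes "m \<ge> 1"
  shows "gca_ideal m d \<subseteq> weight_kernel m d"
  unfolding gca_ideal_def
proof (rule ring.genideal_minimal[OF free_alg_ring ideal_weight_kernel[OF assms]])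
  interpret F: ring "free_alg d" by (rule free_alg_ring)
  have "(\<lambda>w. word (replicate m j) w - word [] w) \<in> weight_kernel m d" if "j \<in> {1..d}" for j
  proof -
    have closed: "word (replicate m j) \<in> carrier (free_alg d)" "word [] \<in> carrier (free_alg d)"
      using that by (auto intro!: word_closed split: if_splits)
    have "inversions (replicate n j) = 0" for n
      by (induction n) auto
    moreover have "same_degree m d (replicate m j) w \<longleftrightarrow> same_degree m d [] w" for w
    proof -
      have "count_list (replicate m j) i = (if i = j then m else 0)" for i
        by (induction m) auto
      then show ?thesis
        by (auto simp: same_degree_def cong_def)
    qed
    ultimately have "word_weight m d w (replicate m j) = word_weight m d w []" for w
      by (simp add: word_weight_def)
    then show ?thesis
      using closed F.minus_closed[OF closed]
      by (simp add: weight_kernel_def linear_ext_diff linear_ext_word free_alg_minus)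
  qed
  moreover have "(\<lambda>w. word [k, l] w - omega m * word [l, k] w) \<in> weight_kernel m d"
    if "k \<in> {1..d}" "l \<in> {1..d}" "k < l" for k l
  proof -
    have closed: "word [k, l] \<in> carrier (free_alg d)"
        "(\<lambda>w. omega m * word [l, k] w) \<in> carrier (free_alg d)"
      using that by (auto intro!: word_closed free_alg_smult_closed)
    \<comment> \<open>The word \<open>[l, k]\<close> has one inversion and \<open>[k, l]\<close> has
      none; the weight \<open>cnj (omega m)\<close> of that inversion cancels the factor \<omega> of
      the relator.\<close>
    have "omega m * cnj (omega m) = 1"
      using complex_norm_square[of "omega m"] by simp
    moreover have "same_degree m d [k, l] w \<longleftrightarrow> same_degree m d [l, k] w" for w
      using same_degree_append_commute[of m d "[k]" "[l]" w] by simp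
    ultimately have "word_weight m d w [k, l] = omega m * word_weight m d w [l, k]" for w
      using that(3) by (simp add: word_weight_def)
    then show ?thesis
      using closed F.minus_closed[OF closed]
      by (simp add: weight_kernel_def linear_ext_diff linear_ext_word linear_ext_smult_word free_alg_minus)
  qed
  moreover have "(\<lambda>w. omega m * word [l, k] w) \<in> carrier (free_alg d)"
    if "k \<in> {1..d}" "l \<in> {1..d}" for k l
    using that by (intro free_alg_smult_closed) auto
  ultimately show "gca_relators m d \<subseteq> weight_kernel m d"
    unfolding gca_relators_def free_gen_eq_word free_gen_pow[unfolded free_gen_eq_word] free_alg_one
    by (auto simp: word_mult free_scalar_mult free_alg_minus)
qed

section \<open>Linear independence and coefficients\<close>

text \<open>Congruent exponents below \<open>m\<close> are equal, and powers of
  \<open>cnj (omega m)\<close> are nonzero. So these functionals are dual to the monomials up to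
  nonzero factors.\<close>

lemma word_weight_monom_word:
  assumes "m \<ge> 1" "J \<in> multi_indices m d" "J' \<in> multi_indices m d"
  shows "word_weight m d (monom_word d J) (monom_word d J') \<noteq> 0 \<longleftrightarrow> J' = J"
proof -
  have less: "J i < m" "J' i < m" if "i \<in> {1..d}" for i
    using that assms by (auto simp: multi_indices_def PiE_iff dest!: bspec[of _ _ i])
  have "same_degree m d (monom_word d J') (monom_word d J) \<longleftrightarrow> (\<forall>i\<in>{1..d}. J' i = J i)"
    using less by (auto simp: same_degree_def count_list_monom_word cong_def)
  also have "\<dots> \<longleftrightarrow> J' = J"
    using assms(2,3) by (auto simp: multi_indices_def intro: PiE_ext)
  moreover have "omega m \<noteq> 0"
    by (simp add: omega_def)
  ultimately show ?thesis
    by (simp add: word_weight_def)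
qed

text \<open>The functional of the degree of \<open>J\<close> vanishes on the ideal and picks out the
  coefficient of \<open>J\<close> from a combination.\<close>

lemma gca_comb_unique:
  assumes "m \<ge> 1" "J \<in> multi_indices m d"
    and eq: "(\<Oplus>\<^bsub>gca m d\<^esub>J\<in>multi_indices m d. gca_scale m d (u J) (gca_monom m d J)) =
      (\<Oplus>\<^bsub>gca m d\<^esub>J\<in>multi_indices m d. gca_scale m d (v J) (gca_monom m d J))"
  shows "u J = v J"
proof -
  define comb where "comb u = (\<lambda>w. \<Sum>J\<in>multi_indices m d. u J * word (monom_word d J) w)" for u
  have closed: "comb u \<in> carrier (free_alg d)" for u
    unfolding comb_def by (rule free_comb_closed)
  have ext: "linear_ext F (comb u) = (\<Sum>J\<in>multi_indices m d. u J * F (monom_word d J))" for F u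
  proof -
    let ?S = "monom_word d ` multi_indices m d"
    have "linear_ext F (comb u) = (\<Sum>w\<in>?S. comb u w * F w)"
    proof (rule linear_ext_superset)
      show "{w. comb u w \<noteq> 0} \<subseteq> ?S"
      proof (rule ccontr)
        assume "\<not> ?thesis"
        then obtain w where w: "comb u w \<noteq> 0" "w \<notin> ?S" by blast
        then have "comb u w = 0"
          unfolding comb_def by (intro sum.neutral) (auto simp: word_def)
        with w show False by simp
      qed
    qed (use finite_multi_indices in simp)
    also have "\<dots> = (\<Sum>J\<in>multi_indices m d. \<Sum>w\<in>?S. u J * word (monom_word d J) w * F w)"
      unfolding comb_def sum_distrib_right by (rule sum.swap)
    also have "\<dots> = (\<Sum>J\<in>multi_indices m d. u J * F (monom_word d J))"
    proof (rule sum.cong[OF refl])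
      fix J assume "J \<in> multi_indices m d"
      have "(\<Sum>w\<in>?S. u J * word (monom_word d J) w * F w) =
          (\<Sum>w\<in>?S. if w = monom_word d J then u J * F (monom_word d J) else 0)"
        by (intro sum.cong) (auto simp: word_def)
      then show "(\<Sum>w\<in>?S. u J * word (monom_word d J) w * F w) = u J * F (monom_word d J)"
        using \<open>J \<in> multi_indices m d\<close> finite_multi_indices by simp
    qed
    finally show ?thesis .
  qed
  let ?W = "word_weight m d (monom_word d J)"
  have "linear_ext ?W (comb u) = u J * ?W (monom_word d J)" for u
  proof -
    have "linear_ext ?W (comb u) = (\<Sum>J'\<in>multi_indices m d. if J' = J then u J * ?W (monom_word d J) else 0)"
      unfolding ext using word_weight_monom_word[OF assms(1,2)] by (intro sum.cong) auto
    then show ?thesis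
      using assms(2) finite_multi_indices by simp
  qed
  moreover have "(\<lambda>w. comb u w - comb v w) \<in> gca_ideal m d"
    using eq closed by (simp add: gca_comb_eq gca_class_eq_iff flip: comb_def)
  then have "linear_ext ?W (\<lambda>w. comb u w - comb v w) = 0"
    using gca_ideal_subset_weight_kernel[OF assms(1)] by (auto simp: weight_kernel_def)
  ultimately have "u J * ?W (monom_word d J) = v J * ?W (monom_word d J)"
    by (simp add: linear_ext_diff[OF closed closed])
  then show ?thesis
    using word_weight_monom_word[OF assms(1,2,2)] by simp
qed

lemma gca_coeff_expansion:
  assumes "m \<ge> 1" "U \<in> carrier (gca m d)"
  shows "U = (\<Oplus>\<^bsub>gca m d\<^esub>J\<in>multi_indices m d. gca_scale m d (gca_coeff m d U J) (gca_monom m d J))"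
proof -
  let ?expands = "\<lambda>u. u \<in> extensional (multi_indices m d) \<and>
       U = (\<Oplus>\<^bsub>gca m d\<^esub>J\<in>multi_indices m d. gca_scale m d (u J) (gca_monom m d J))"
  obtain u where u: "U = (\<Oplus>\<^bsub>gca m d\<^esub>J\<in>multi_indices m d. gca_scale m d (u J) (gca_monom m d J))"
    using gca_comb_exists[OF assms] .
  \<comment> \<open>The sum determines coefficients only on \<open>multi_indices m d\<close>;
    elsewhere \<open>restrict\<close> supplies the value that \<open>extensional\<close> prescribes,
    which makes the description unique.\<close>
  have "?expands (restrict u (multi_indices m d))"
    by (simp add: u gca_comb_eq)
  moreover have "v = w" if "?expands v" "?expands w" for v w
  proof (rule extensionalityI)
    fix J assume "J \<in> multi_indices m d"
    from assms(1) this show "v J = w J"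
      by (rule gca_comb_unique) (use that in simp)
  qed (use that in auto)
  ultimately have "\<exists>!u. ?expands u"
    by blast
  from theI'[OF this] show ?thesis
    by (simp add: gca_coeff_def)
qed

section \<open>Unitary representations\<close>

text \<open>Since \<open>e_i^m = e\<close> and \<open>m \<ge> 1\<close>, the power
  \<open>e_i^(m-1)\<close> is a two-sided inverse.\<close>

lemma gca_gen_unit:
  assumes "m \<ge> 1" "i \<in> {1..d}"
  shows "gca_gen m d i \<in> Units (gca m d)"
proof -
  interpret G: ring "gca m d" by (rule gca_ring)
  have closed: "gca_gen m d i \<in> carrier (gca m d)"
    using assms(2) by (simp add: gca_gen_eq)
  have "gca_gen m d i [^]\<^bsub>gca m d\<^esub> m = \<one>\<^bsub>gca m d\<^esub>"
    using assms(2) by (simp add: gca_gen_pow gca_class_power gca_class_one)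
  then have "gca_gen m d i [^]\<^bsub>gca m d\<^esub> Suc (m - 1) = \<one>\<^bsub>gca m d\<^esub>"
    using assms(1) by simp
  moreover from this have "gca_gen m d i \<otimes>\<^bsub>gca m d\<^esub> gca_gen m d i [^]\<^bsub>gca m d\<^esub> (m - 1) = \<one>\<^bsub>gca m d\<^esub>"
    using closed by (metis G.nat_pow_Suc2)
  ultimately show ?thesis
    using closed by (auto simp: Units_def intro!: bexI[of _ "gca_gen m d i [^]\<^bsub>gca m d\<^esub> (m - 1)"])
qed

section \<open>Representations with unitary images of the generators\<close>

context
  fixes m d N :: nat and \<beta> :: "(nat list \<Rightarrow> complex) set \<Rightarrow> complex mat"
  assumes m: "m \<ge> 1" and rep: "matrix_rep m d N \<beta>"
    and unitary_gen: "\<And>i. i \<in> {1..d} \<Longrightarrow> unitary_mat (\<beta> (gca_gen m d i))"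
begin

interpretation G: ring "gca m d" by (rule gca_ring)

lemma rep_closed: "U \<in> carrier (gca m d) \<Longrightarrow> \<beta> U \<in> carrier_mat N N"
  and rep_mult: "U \<in> carrier (gca m d) \<Longrightarrow> V \<in> carrier (gca m d) \<Longrightarrow>
    \<beta> (U \<otimes>\<^bsub>gca m d\<^esub> V) = \<beta> U * \<beta> V"
  and rep_add: "U \<in> carrier (gca m d) \<Longrightarrow> V \<in> carrier (gca m d) \<Longrightarrow>
    \<beta> (U \<oplus>\<^bsub>gca m d\<^esub> V) = \<beta> U + \<beta> V"
  and rep_one: "\<beta> \<one>\<^bsub>gca m d\<^esub> = 1\<^sub>m N"
  and rep_scale: "U \<in> carrier (gca m d) \<Longrightarrow> \<beta> (gca_scale m d c U) = c \<cdot>\<^sub>m \<beta> U"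
  using rep by (auto simp: matrix_rep_def Ring.ring_hom_def ring_mat_simps Pi_iff)

text \<open>\<open>Ring.ring_hom\<close> does not mention zero, so the value there comes from
  scaling by 0. It serves the empty sum in \<open>rep_bar\<close>.\<close>

lemma rep_zero: "\<beta> \<zero>\<^bsub>gca m d\<^esub> = 0\<^sub>m N N"
proof -
  have "\<zero>\<^bsub>gca m d\<^esub> = gca_scale m d 0 \<zero>\<^bsub>gca m d\<^esub>"
    by (simp add: gca_scale_def)
  then have "\<beta> \<zero>\<^bsub>gca m d\<^esub> = 0 \<cdot>\<^sub>m \<beta> \<zero>\<^bsub>gca m d\<^esub>"
    using rep_scale[of "\<zero>\<^bsub>gca m d\<^esub>" 0] by simp
  also have "\<dots> = 0\<^sub>m N N"
    using rep_closed[of "\<zero>\<^bsub>gca m d\<^esub>"] by (intro eq_matI) auto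
  finally show ?thesis .
qed

lemma gca_monom_unit_unitary:
  "gca_monom m d J \<in> Units (gca m d)" "unitary_mat (\<beta> (gca_monom m d J))"
proof -
  \<comment> \<open>This set contains the generators and is closed under products, so the
    \<open>foldr\<close> defining a monomial stays inside it.\<close>
  let ?S = "{U \<in> Units (gca m d). unitary_mat (\<beta> U)}"
  have mult: "U \<otimes>\<^bsub>gca m d\<^esub> V \<in> ?S" if "U \<in> ?S" "V \<in> ?S" for U V
  proof -
    have "U \<in> carrier (gca m d)" "V \<in> carrier (gca m d)"
      using that by auto
    then have "dim_row (\<beta> U) = dim_row (\<beta> V)" "\<beta> (U \<otimes>\<^bsub>gca m d\<^esub> V) = \<beta> U * \<beta> V"
      using rep_closed[of U] rep_closed[of V] by (simp_all add: rep_mult)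
    then show ?thesis
      using that by (simp add: unitary_mat_mult)
  qed
  have one: "\<one>\<^bsub>gca m d\<^esub> \<in> ?S"
    by (simp add: rep_one)
  have gen: "gca_gen m d i \<in> ?S" if "i \<in> {1..d}" for i
    using that m unitary_gen by (simp add: gca_gen_unit)
  have pow: "gca_gen m d i [^]\<^bsub>gca m d\<^esub> (n :: nat) \<in> ?S" if "i \<in> {1..d}" for i n
    by (induction n) (use one mult gen[OF that] in \<open>simp_all only: G.nat_pow_0 G.nat_pow_Suc\<close>)
  have "foldr (\<lambda>i x. (gca_gen m d i [^]\<^bsub>gca m d\<^esub> J i) \<otimes>\<^bsub>gca m d\<^esub> x) is \<one>\<^bsub>gca m d\<^esub> \<in> ?S"
    if "set is \<subseteq> {1..d}" for "is"
    using that
  proof (induction "is")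
    case Nil
    show ?case using one by simp
  next
    case (Cons i "is")
    then show ?case
      using mult[OF pow[of i "J i"]] by simp
  qed
  moreover have "set [1..<d+1] \<subseteq> {1..d}"
    by auto
  ultimately have "gca_monom m d J \<in> ?S"
    unfolding gca_monom_def by blast
  then show "gca_monom m d J \<in> Units (gca m d)" "unitary_mat (\<beta> (gca_monom m d J))"
    by simp_all
qed

text \<open>Both sides are inverses of \<open>\<beta> U\<close>, and inverses are unique.\<close>

lemma rep_inv:
  assumes "U \<in> Units (gca m d)" "unitary_mat (\<beta> U)"
  shows "\<beta> (inv\<^bsub>gca m d\<^esub> U) = mat_adjoint (\<beta> U)"
proof -
  have U: "\<beta> U \<in> carrier_mat N N" and V: "\<beta> (inv\<^bsub>gca m d\<^esub> U) \<in> carrier_mat N N"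
    using assms(1) by (auto intro!: rep_closed)
  have "\<beta> U * \<beta> (inv\<^bsub>gca m d\<^esub> U) = 1\<^sub>m N"
    using assms(1) rep_mult[of U "inv\<^bsub>gca m d\<^esub> U"] G.Units_closed[OF assms(1)]
    by (simp add: rep_one)
  then have "mat_adjoint (\<beta> U) * (\<beta> U * \<beta> (inv\<^bsub>gca m d\<^esub> U)) = mat_adjoint (\<beta> U)"
    using U by (simp add: right_mult_one_mat[where nr = N])
  moreover have "mat_adjoint (\<beta> U) * (\<beta> U * \<beta> (inv\<^bsub>gca m d\<^esub> U)) =
      mat_adjoint (\<beta> U) * \<beta> U * \<beta> (inv\<^bsub>gca m d\<^esub> U)"
    using U V by (intro assoc_mult_mat[symmetric]) auto
  moreover have "\<dots> = \<beta> (inv\<^bsub>gca m d\<^esub> U)"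
    using U V by (simp add: unitary_mat_adjoint_mult[OF assms(2)] left_mult_one_mat[where nc = N])
  ultimately show ?thesis
    by simp
qed

lemma rep_bar:
  assumes "U \<in> carrier (gca m d)"
  shows "mat_adjoint (\<beta> U) = \<beta> (gca_bar m d U)"
proof -
  let ?c = "gca_coeff m d U"
  have monom: "gca_monom m d J \<in> carrier (gca m d)"
      "inv\<^bsub>gca m d\<^esub> (gca_monom m d J) \<in> carrier (gca m d)" for J
    using gca_monom_unit_unitary(1)[of J] by auto
  \<comment> \<open>The coefficients \<open>?c\<close> stay those of \<open>U\<close> while the
    index set \<open>A\<close> grows, so the induction never meets coefficients of a partial
    sum.\<close>
  have "mat_adjoint (\<beta> (\<Oplus>\<^bsub>gca m d\<^esub>J\<in>A. gca_scale m d (?c J) (gca_monom m d J))) =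
      \<beta> (\<Oplus>\<^bsub>gca m d\<^esub>J\<in>A. gca_scale m d (cnj (?c J)) (inv\<^bsub>gca m d\<^esub> (gca_monom m d J)))"
    if "finite A" for A
    using that
  proof induction
    case (insert J A)
    have "mat_adjoint (\<beta> (gca_scale m d (?c J) (gca_monom m d J))) =
        \<beta> (gca_scale m d (cnj (?c J)) (inv\<^bsub>gca m d\<^esub> (gca_monom m d J)))"
      using monom gca_monom_unit_unitary by (simp add: rep_scale rep_inv mat_adjoint_smult)
    with insert show ?case
      using monom
      by (simp add: gca_scale_closed rep_add rep_closed mat_adjoint_add[where n = N and k = N])
  qed (simp add: rep_zero)
  from this[OF finite_multi_indices[of m d]] show ?thesis
    using gca_coeff_expansion[OF m assms] by (simp add: gca_bar_def)
qed

end

theorem theorem5p1: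
  fixes m d :: nat and \<zeta> :: complex and \<sigma> :: "nat \<Rightarrow> nat"
    and \<beta> :: "(nat list \<Rightarrow> complex) set \<Rightarrow> complex mat"
  assumes "m \<ge> 1"
    and "even m \<Longrightarrow> primitive_unity_root (2 * m) \<zeta> \<and> \<zeta>\<^sup>2 = omega m"
    and "\<sigma> permutes {1..d}"
    and "matrix_rep m d (rep_size m d) \<beta>"
    and "\<And>i. i \<in> {1..d} \<Longrightarrow> \<beta> (gca_gen m d i) = beta_gen m \<zeta> d (\<sigma> i)"
  shows "\<forall>U\<in>carrier (gca m d). mat_adjoint (\<beta> U) = \<beta> (gca_bar m d U)"
proof -
  have "cmod \<zeta> = 1" if "even m"
  proof -
    have "(cmod \<zeta>)\<^sup>2 = 1"
      using assms(2)[OF that] by (simp flip: norm_power)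
    then show ?thesis
      using norm_ge_zero[of \<zeta>] by (auto simp: power2_eq_1_iff)
  qed
  \<comment> \<open>\<open>unitary_mat_beta_gen\<close> holds at every index, in particular at
    \<open>\<sigma> i\<close>.\<close>
  then have "unitary_mat (\<beta> (gca_gen m d i))" if "i \<in> {1..d}" for i
    using assms(1,5) that by (simp add: unitary_mat_beta_gen)
  then show ?thesis
    using rep_bar[OF assms(1,4)] by blast
qed

end
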